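(* Let $f:\mathbb{R}^d\to\mathbb{R}$ be $\tau$-strongly convex and $L$-smooth, with $\gamma$-Lipschitz continuous Hessian $\nabla^2 f$, and let $x^\star$ be its minimizer. Let $x_t\in\mathbb{R}^d$ be the current iterate of the ZO-HessAware algorithm, with smoothing parameter $\mu>0$ and batch size $b$, and let the approximate Hessian $\tilde H_t$ (symmetric positive definite) satisfy $$\rho\,\tilde H_t\preceq\nabla^2 f(x_t)\preceq(2-\rho)\,\tilde H_t,\qquad \zeta I_d\preceq\tilde H_t,$$ with $0<\rho\le 1$ and $\zeta>0$. Set the step size $\eta=\frac{b}{16(d+2)}$ with $b\le d+2$. If $$\|x_t-x^\star\|\le\frac{\rho}{\gamma}\cdot\min\left(\frac{3\tau\zeta^{1/2}}{64L^{1/2}},\ \frac{d^{3/2}\zeta^2}{33L(d+2)b^2}\right),$$ then the next iterate $x_{t+1}$ satisfies $$\mathbb{E}\left[f(x_{t+1})-f(x^\star)\right]\le\left(1-\frac{b\rho}{64(d+2)}\right)\left(f(x_t)-f(x^\star)\right)+\Delta_\mu,$$ where $$\Delta_\mu=b\cdot\left(\frac{\mu^2L^2}{64\zeta^2}(d+5)^2+\frac{\mu^2L^2}{128\zeta}(d+38)+\frac{\gamma b^2\mu^3L^3}{6144\,\zeta^{9/2}}(d+110)^{3/2}\right).$$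
   Context: $L$-smooth: $\|\nabla f(x)-\nabla f(y)\|\le L\|x-y\|$ for all $x,y$. $\tau$-strongly convex: $f(y)\ge f(x)+\langle\nabla f(x),y-x\rangle+\frac{\tau}{2}\|x-y\|^2$ for all $x,y$. $\gamma$-Lipschitz Hessian: $\|\nabla^2 f(y)-\nabla^2 f(x)\|\le\gamma\|y-x\|$ for all $x,y$ (spectral norm on the left). $B\preceq A$ means $A-B$ is positive semi-definite. One step of ZO-HessAware from $x_t$: draw independent $u_1,\dots,u_b\sim N(0,I_d)$, set $$\tilde g_\mu(x_t)=\frac1b\sum_{i=1}^b\frac{f(x_t+\mu\tilde H_t^{-1/2}u_i)-f(x_t)}{\mu}\,\tilde H_t^{-1/2}u_i,\qquad x_{t+1}=x_t-\eta\,\tilde g_\mu(x_t).$$ The expectation is over $u_1,\dots,u_b$, with $x_t$ and $\tilde H_t$ fixed. *)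

theory Defs
  imports "HOL-Probability.Probability"
begin

definition gradient :: "('a::real_inner \<Rightarrow> real) \<Rightarrow> 'a \<Rightarrow> 'a" where
  "gradient f x = (THE g. GDERIV f x :> g)"

definition hessian :: "(real ^ 'n \<Rightarrow> real) \<Rightarrow> real ^ 'n \<Rightarrow> real ^ 'n ^ 'n" where
  "hessian f x = jacobian (gradient f) (at x)"

text \<open>\<^const>\<open>gradient\<close> and \<^const>\<open>hessian\<close> are total, so the predicates below carry the
  differentiability that makes their values meaningful.\<close>

definition L_smooth :: "real \<Rightarrow> (real ^ 'n \<Rightarrow> real) \<Rightarrow> bool" where
  "L_smooth L f \<longleftrightarrow> (\<forall>x. f differentiable (at x)) \<and>
     (\<forall>x y. norm (gradient f x - gradient f y) \<le> L * norm (x - y))"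

definition strongly_convex :: "real \<Rightarrow> (real ^ 'n \<Rightarrow> real) \<Rightarrow> bool" where
  "strongly_convex \<tau> f \<longleftrightarrow> (\<forall>x. f differentiable (at x)) \<and>
     (\<forall>x y. f y \<ge> f x + gradient f x \<bullet> (y - x) + \<tau> / 2 * (norm (y - x))\<^sup>2)"

definition lipschitz_hessian :: "real \<Rightarrow> (real ^ 'n \<Rightarrow> real) \<Rightarrow> bool" where
  "lipschitz_hessian \<gamma> f \<longleftrightarrow> (\<forall>x. f differentiable (at x)) \<and>
     (\<forall>x. gradient f differentiable (at x)) \<and>
     (\<forall>x y. onorm ((*v) (hessian f y - hessian f x)) \<le> \<gamma> * norm (y - x))"

definition psd :: "real ^ 'n ^ 'n \<Rightarrow> bool" where
  "psd A \<longleftrightarrow> transpose A = A \<and> (\<forall>v. 0 \<le> v \<bullet> (A *v v))"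

definition pos_def :: "real ^ 'n ^ 'n \<Rightarrow> bool" where
  "pos_def A \<longleftrightarrow> transpose A = A \<and> (\<forall>v. v \<noteq> 0 \<longrightarrow> 0 < v \<bullet> (A *v v))"

definition loewner_le :: "real ^ 'n ^ 'n \<Rightarrow> real ^ 'n ^ 'n \<Rightarrow> bool" (infix \<open>\<preceq>\<^sub>L\<close> 50) where
  "B \<preceq>\<^sub>L A \<longleftrightarrow> psd (A - B)"

definition psd_sqrt :: "real ^ 'n ^ 'n \<Rightarrow> real ^ 'n ^ 'n" where
  "psd_sqrt A = (THE S. psd S \<and> S ** S = A)"

definition inv_sqrt :: "real ^ 'n ^ 'n \<Rightarrow> real ^ 'n ^ 'n" where
  "inv_sqrt A = matrix_inv (psd_sqrt A)"

definition std_gaussian_density :: "real ^ 'n \<Rightarrow> real" where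
  "std_gaussian_density v = (\<Prod>j\<in>UNIV. std_normal_density (v $ j))"

text \<open>In the next two definitions \<open>u i\<close>, for \<open>1 \<le> i \<le> b\<close>, are the sampled directions.\<close>

definition zo_gradient ::
  "(real ^ 'n \<Rightarrow> real) \<Rightarrow> real \<Rightarrow> nat \<Rightarrow> real ^ 'n ^ 'n \<Rightarrow> real ^ 'n \<Rightarrow> (nat \<Rightarrow> real ^ 'n) \<Rightarrow> real ^ 'n" where
  "zo_gradient f \<mu> b H x u =
     (1 / real b) *\<^sub>R (\<Sum>i=1..b.
        ((f (x + \<mu> *\<^sub>R (inv_sqrt H *v u i)) - f x) / \<mu>) *\<^sub>R (inv_sqrt H *v u i))"

definition zo_step ::
  "(real ^ 'n \<Rightarrow> real) \<Rightarrow> real \<Rightarrow> real \<Rightarrow> nat \<Rightarrow> real ^ 'n ^ 'n \<Rightarrow> real ^ 'n \<Rightarrow> (nat \<Rightarrow> real ^ 'n) \<Rightarrow> real ^ 'n" where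
  "zo_step f \<eta> \<mu> b H x u = x - \<eta> *\<^sub>R zo_gradient f \<mu> b H x u"

definition zo_error :: "nat \<Rightarrow> nat \<Rightarrow> real \<Rightarrow> real \<Rightarrow> real \<Rightarrow> real \<Rightarrow> real" where
  "zo_error d b L \<gamma> \<zeta> \<mu> = real b *
     (\<mu>\<^sup>2 * L\<^sup>2 / (64 * \<zeta>\<^sup>2) * (real d + 5)\<^sup>2
      + \<mu>\<^sup>2 * L\<^sup>2 / (128 * \<zeta>) * (real d + 38)
      + \<gamma> * (real b)\<^sup>2 * \<mu> ^ 3 * L ^ 3 / (6144 * \<zeta> powr (9/2)) * (real d + 110) powr (3/2))"

end

theory Submission
  imports Defs
begin

text \<open>Write \<open>W = H\<^sup>-\<^sup>1\<^sup>/\<^sup>2\<close>, \<open>g = W \<nabla>f(x)\<close> and \<open>c = \<mu> L / (2 \<zeta>)\<close>. The step is \<open>- \<eta> W G\<close>, where \<open>G\<close> is the mean of the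
  vectors \<open>(g \<bullet> u\<^sub>i + e(u\<^sub>i)) u\<^sub>i\<close> with \<open>\<bar>e(u)\<bar> \<le> c \<parallel>u\<parallel>\<^sup>2\<close> by smoothness. A third-order Taylor expansion with
  \<open>\<nabla>\<^sup>2f(x) \<preceq> 2 H\<close> gives
  \<open>f(x - \<eta> W G) \<le> f(x) - \<eta> g \<bullet> G + \<eta>\<^sup>2 \<parallel>G\<parallel>\<^sup>2 + \<gamma> \<eta>\<^sup>3 \<parallel>G\<parallel>\<^sup>3 / (6 \<zeta>\<^sup>3\<^sup>/\<^sup>2)\<close>.
  Gaussian moments up to order ten bound the three expectations; independence enters only through
  \<open>E \<parallel>G\<parallel>\<^sup>2\<close>, where it keeps the variance term of order \<open>d \<parallel>g\<parallel>\<^sup>2 / b\<close>. The second closeness bound makes the cubic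
  term in \<open>\<parallel>g\<parallel>\<close> negligible against \<open>\<eta> \<parallel>g\<parallel>\<^sup>2\<close>, and the first one gives
  \<open>f(x) - f(x\<^sup>\<star>) \<le> (32/63) \<parallel>g\<parallel>\<^sup>2 / \<rho>\<close>, so a decrease by a multiple of \<open>\<eta> \<parallel>g\<parallel>\<^sup>2\<close> is a contraction.\<close>

subsection \<open>Gaussian moments\<close>

text \<open>Two obstacles shape the moment bounds: the remainder \<open>e\<close> makes the
  estimator biased, so that the mean of \<open>G\<close> need not be \<open>g\<close>, and products
  such as powers of \<open>g \<bullet> u\<close> and \<open>norm u\<close> are correlated. Both are
  met by Young's inequality with a tuned weight, which splits odd or mixed moments into pure even
  ones with closed forms. The factors lost are paid from slack in the constants. The step size is
  fitted to the variance: \<open>\<eta>\<close> times \<open>4 * (d + 2) / b\<close> is 1/4, and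
  \<open>b \<le> d + 2\<close> gives \<open>\<eta>\<close> at most 1/16. In units of
  \<open>\<eta>\<close> times the squared norm of \<open>g\<close>, the linear term gains 7/8, the
  quadratic one costs 3/8 and the cubic one at most 1/100. This leaves 49/100, while the contraction
  asks for 8/63, a quarter of 32/63. Strong convexity alone would bound the gap with a condition
  number in the rate. Comparing the Hessian with \<open>H\<close> puts \<open>\<rho>\<close> there
  instead, and strong convexity only absorbs the third-order error. Matrix square roots are built by
  a contraction and shown unique by traces, without spectral decomposition.\<close>

lemma std_gaussian_density_eq_prod_Basis:
  fixes v :: "real ^ 'n"
  shows "std_gaussian_density v = (\<Prod>b\<in>Basis. std_normal_density (v \<bullet> b))"
proof -
  have B: "(Basis :: (real^'n) set) = range (\<lambda>j. axis j 1)"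
    by (auto simp: Basis_vec_def)
  have "inj (\<lambda>j::'n. axis j (1::real))"
    by (simp add: inj_def axis_eq_axis)
  then show ?thesis
    unfolding B std_gaussian_density_def by (simp add: prod.reindex inner_axis)
qed

lemma std_gaussian_density_nonneg: "0 \<le> std_gaussian_density v"
  unfolding std_gaussian_density_def by (intro prod_nonneg) auto

section \<open>Coordinates of a Gaussian vector, and powers of independent sums\<close>

context prob_space
begin

text \<open>Laws on a finite product that agree on boxes are equal. On a box the density factorizes,
  and \<open>lborel\<close> is the image of a product of copies of \<open>lborel\<close>, so the
  integral splits. Marginals and independence of the coordinates are both read off from
  this.\<close>

lemma gaussian_distr_coordinates:
  fixes X :: "'a \<Rightarrow> real ^ 'n"
  assumes X: "distributed M lborel X (\<lambda>v. ennreal (std_gaussian_density v))"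
  shows "distr M (\<Pi>\<^sub>M b\<in>Basis. borel) (\<lambda>\<omega>. \<lambda>b\<in>Basis. X \<omega> \<bullet> b)
    = (\<Pi>\<^sub>M b\<in>(Basis :: (real^'n) set). density lborel (\<lambda>x. ennreal (std_normal_density x)))"
proof -
  define D where "D = (\<lambda>b::real^'n. density lborel (\<lambda>x. ennreal (std_normal_density x)))"
  have D[simp]: "sets (D b) = sets borel" for b
    by (simp add: D_def)
  interpret PD: product_prob_space D UNIV
    unfolding D_def by (intro product_prob_spaceI prob_space_normal_density) auto
  interpret PL: product_sigma_finite "\<lambda>b::real^'n. lborel :: real measure"
    by (simp add: product_sigma_finite_def lborel.sigma_finite_measure_axioms)
  have Xm[measurable]: "X \<in> borel_measurable M"
    using distributed_measurable[OF X] by simp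
  have "distr M (\<Pi>\<^sub>M b\<in>Basis. borel) (\<lambda>\<omega>. \<lambda>b\<in>Basis. X \<omega> \<bullet> b) = PiM Basis D"
  proof (rule PD.PiM_eqI)
    show "sets (distr M (\<Pi>\<^sub>M b\<in>Basis. borel) (\<lambda>\<omega>. \<lambda>b\<in>Basis. X \<omega> \<bullet> b)) = sets (PiM Basis D)"
      by (simp cong: sets_PiM_cong)
    fix A :: "real^'n \<Rightarrow> real set"
    assume A: "\<And>i. i \<in> Basis \<Longrightarrow> A i \<in> sets (D i)"
    then have A'[measurable]: "\<And>i. i \<in> Basis \<Longrightarrow> A i \<in> sets borel" by simp
    let ?S = "{v::real^'n. \<forall>b\<in>Basis. v \<bullet> b \<in> A b}"
    have S[measurable]: "?S \<in> sets borel"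
    proof -
      have "?S = (\<Inter>b\<in>Basis. (\<lambda>v. v \<bullet> b) -` A b \<inter> space borel)" by auto
      also have "\<dots> \<in> sets borel"
        by (intro sets.finite_INT measurable_sets[OF _ A']) auto
      finally show ?thesis .
    qed
    have "emeasure (distr M (\<Pi>\<^sub>M b\<in>Basis. borel) (\<lambda>\<omega>. \<lambda>b\<in>Basis. X \<omega> \<bullet> b)) (Pi\<^sub>E Basis A)
        = emeasure M ((\<lambda>\<omega>. \<lambda>b\<in>Basis. X \<omega> \<bullet> b) -` Pi\<^sub>E Basis A \<inter> space M)"
      by (intro emeasure_distr) (auto intro!: sets_PiM_I_finite A')
    also have "(\<lambda>\<omega>. \<lambda>b\<in>Basis. X \<omega> \<bullet> b) -` Pi\<^sub>E Basis A \<inter> space M = X -` ?S \<inter> space M"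
      by (auto simp: PiE_iff)
    also have "emeasure M (X -` ?S \<inter> space M)
        = (\<integral>\<^sup>+v. ennreal (std_gaussian_density v) * indicator ?S v \<partial>lborel)"
      by (rule distributed_emeasure[OF X]) simp
    also have "\<dots> = (\<integral>\<^sup>+v. (\<Prod>b\<in>Basis. ennreal (std_normal_density (v \<bullet> b)) * indicator (A b) (v \<bullet> b)) \<partial>lborel)"
    proof (intro nn_integral_cong)
      fix v :: "real^'n"
      have "(indicator ?S v :: ennreal) = (\<Prod>b\<in>Basis. indicator (A b) (v \<bullet> b))"
        by (auto simp: indicator_def prod_eq_1_iff)
      then show "ennreal (std_gaussian_density v) * indicator ?S v
          = (\<Prod>b\<in>Basis. ennreal (std_normal_density (v \<bullet> b)) * indicator (A b) (v \<bullet> b))"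
        by (simp add: std_gaussian_density_eq_prod_Basis prod.distrib prod_ennreal)
    qed
    also have "\<dots> = (\<integral>\<^sup>+f. (\<Prod>b\<in>Basis. ennreal (std_normal_density (f b)) * indicator (A b) (f b))
        \<partial>(\<Pi>\<^sub>M b\<in>(Basis :: (real^'n) set). lborel))"
      by (subst lborel_eq, subst nn_integral_distr)
         (auto intro!: nn_integral_cong prod.cong)
    also have "\<dots> = (\<Prod>b\<in>(Basis :: (real^'n) set). \<integral>\<^sup>+x. ennreal (std_normal_density x) * indicator (A b) x \<partial>lborel)"
      by (rule PL.product_nn_integral_prod) auto
    also have "\<dots> = (\<Prod>b\<in>Basis. emeasure (D b) (A b))"
      by (intro prod.cong refl) (simp add: D_def emeasure_density)
    finally show "emeasure (distr M (\<Pi>\<^sub>M b\<in>Basis. borel) (\<lambda>\<omega>. \<lambda>b\<in>Basis. X \<omega> \<bullet> b)) (Pi\<^sub>E Basis A)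
        = (\<Prod>b\<in>Basis. emeasure (D b) (A b))" .
  qed simp
  then show ?thesis by (simp add: D_def)
qed

lemma gaussian_coordinate_distr:
  fixes X :: "'a \<Rightarrow> real ^ 'n"
  assumes X: "distributed M lborel X (\<lambda>v. ennreal (std_gaussian_density v))" and b: "b \<in> Basis"
  shows "distributed M lborel (\<lambda>\<omega>. X \<omega> \<bullet> b) (\<lambda>x. ennreal (std_normal_density x))"
proof -
  have Xm[measurable]: "X \<in> borel_measurable M"
    using distributed_measurable[OF X] by simp
  have "distr M borel (\<lambda>\<omega>. X \<omega> \<bullet> b)
      = distr (distr M (\<Pi>\<^sub>M b\<in>Basis. borel) (\<lambda>\<omega>. \<lambda>b\<in>Basis. X \<omega> \<bullet> b)) borel (\<lambda>f. f b)"
    using b by (subst distr_distr) (auto simp: comp_def)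
  also have "\<dots> = distr (\<Pi>\<^sub>M b\<in>(Basis :: (real^'n) set). density lborel (\<lambda>x. ennreal (std_normal_density x)))
      (density lborel (\<lambda>x. ennreal (std_normal_density x))) (\<lambda>f. f b)"
    unfolding gaussian_distr_coordinates[OF X] by (intro distr_cong) auto
  also have "\<dots> = density lborel (\<lambda>x. ennreal (std_normal_density x))"
    using b by (intro distr_PiM_component prob_space_normal_density) auto
  finally have *: "distr M borel (\<lambda>\<omega>. X \<omega> \<bullet> b) = density lborel (\<lambda>x. ennreal (std_normal_density x))" .
  have "distr M lborel (\<lambda>\<omega>. X \<omega> \<bullet> b) = distr M borel (\<lambda>\<omega>. X \<omega> \<bullet> b)"
    by (intro distr_cong) auto
  with * show ?thesis unfolding distributed_def by auto
qed

lemma gaussian_coordinates_indep: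
  fixes X :: "'a \<Rightarrow> real ^ 'n"
  assumes X: "distributed M lborel X (\<lambda>v. ennreal (std_gaussian_density v))"
  shows "indep_vars (\<lambda>_. borel) (\<lambda>b \<omega>. X \<omega> \<bullet> b) Basis"
proof -
  have Xm[measurable]: "X \<in> borel_measurable M"
    using distributed_measurable[OF X] by simp
  have "distr M borel (\<lambda>\<omega>. X \<omega> \<bullet> b) = density lborel (\<lambda>x. ennreal (std_normal_density x))"
    if "b \<in> Basis" for b
  proof -
    have "distr M borel (\<lambda>\<omega>. X \<omega> \<bullet> b) = distr M lborel (\<lambda>\<omega>. X \<omega> \<bullet> b)"
      by (intro distr_cong) auto
    with gaussian_coordinate_distr[OF X that] show ?thesis unfolding distributed_def by simp
  qed
  then show ?thesis
    by (subst indep_vars_iff_distr_eq_PiM')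
       (auto simp: gaussian_distr_coordinates[OF X] cong: PiM_cong)
qed

lemma has_bochner_integral_indep_mult:
  fixes X Y :: "'a \<Rightarrow> real"
  assumes "indep_var borel X borel Y" "has_bochner_integral M X a" "has_bochner_integral M Y b"
  shows "has_bochner_integral M (\<lambda>\<omega>. X \<omega> * Y \<omega>) (a * b)"
  using indep_var_integrable[OF assms(1)] indep_var_lebesgue_integral[OF assms(1)] assms(2,3)
  by (auto simp: has_bochner_integral_iff)

text \<open>Binomial expansion, with independence factoring each product of powers. It is the
  induction step of both moment computations below.\<close>

lemma has_bochner_integral_indep_sum_power:
  fixes X Y :: "'a \<Rightarrow> real"
  assumes ind: "indep_var borel X borel Y"
    and X: "\<And>k. k \<le> n \<Longrightarrow> has_bochner_integral M (\<lambda>\<omega>. X \<omega> ^ k) (a k)"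
    and Y: "\<And>k. k \<le> n \<Longrightarrow> has_bochner_integral M (\<lambda>\<omega>. Y \<omega> ^ k) (c k)"
  shows "has_bochner_integral M (\<lambda>\<omega>. (X \<omega> + Y \<omega>) ^ n) (\<Sum>k\<le>n. real (n choose k) * (a k * c (n - k)))"
proof -
  have "has_bochner_integral M (\<lambda>\<omega>. X \<omega> ^ k * Y \<omega> ^ (n - k)) (a k * c (n - k))" if "k \<le> n" for k
    using has_bochner_integral_indep_mult[OF _ X[OF that] Y, of "n - k"] that
      indep_var_compose[OF ind, of "\<lambda>x. x ^ k" borel "\<lambda>x. x ^ (n - k)" borel]
    by (simp add: comp_def)
  then have "has_bochner_integral M (\<lambda>\<omega>. \<Sum>k\<le>n. real (n choose k) * (X \<omega> ^ k * Y \<omega> ^ (n - k)))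
      (\<Sum>k\<le>n. real (n choose k) * (a k * c (n - k)))"
    by (intro has_bochner_integral_sum has_bochner_integral_mult_right) auto
  then show ?thesis by (simp add: binomial_ring mult.assoc)
qed

lemma std_normal_power_even:
  assumes "distributed M lborel Z (\<lambda>x. ennreal (std_normal_density x))"
  shows "has_bochner_integral M (\<lambda>\<omega>. Z \<omega> ^ (2 * k)) (fact (2 * k) / (2 ^ k * fact k))"
  using normal_moment_even[where \<mu>=0 and \<sigma>=1 and k=k] distributed_integrable[OF assms, of "\<lambda>x. x ^ (2 * k)"]
    distributed_integral[OF assms, of "\<lambda>x. x ^ (2 * k)"]
  by (simp add: has_bochner_integral_iff)

lemma std_normal_power_odd:
  assumes "distributed M lborel Z (\<lambda>x. ennreal (std_normal_density x))"
  shows "has_bochner_integral M (\<lambda>\<omega>. Z \<omega> ^ (2 * k + 1)) 0"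
  using normal_moment_odd[where \<mu>=0 and \<sigma>=1 and k=k] distributed_integrable[OF assms, of "\<lambda>x. x ^ (2 * k + 1)"]
    distributed_integral[OF assms, of "\<lambda>x. x ^ (2 * k + 1)"]
  by (simp add: has_bochner_integral_iff)

end

text \<open>The parameter \<open>s\<close> is the variance, not the standard deviation.\<close>
definition normal_moment :: "real \<Rightarrow> nat \<Rightarrow> real" where
  "normal_moment s k = (if even k then s ^ (k div 2) * (fact k / (2 ^ (k div 2) * fact (k div 2))) else 0)"

text \<open>The \<open>k\<close>-th raw moment of the chi-squared law with \<open>m\<close> degrees
  of freedom.\<close>

definition chi2_moment :: "real \<Rightarrow> nat \<Rightarrow> real" where
  "chi2_moment m k = (\<Prod>i<k. m + 2 * real i)"

lemma normal_moment_values: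
  "normal_moment s 0 = 1" "normal_moment s 1 = 0" "normal_moment s 2 = s" "normal_moment s 3 = 0"
  "normal_moment s 4 = 3 * s\<^sup>2" "normal_moment s 5 = 0" "normal_moment s 6 = 15 * s ^ 3"
  by (auto simp: normal_moment_def fact_numeral)

lemma chi2_moment_values:
  "chi2_moment m 0 = 1" "chi2_moment m 1 = m" "chi2_moment m 2 = m * (m + 2)"
  "chi2_moment m 3 = m * (m + 2) * (m + 4)" "chi2_moment m 4 = m * (m + 2) * (m + 4) * (m + 6)"
  "chi2_moment m 5 = m * (m + 2) * (m + 4) * (m + 6) * (m + 8)"
  by (simp_all add: chi2_moment_def eval_nat_numeral)

lemma sum_atMost_values:
  fixes F :: "nat \<Rightarrow> real"
  shows "(\<Sum>k\<le>2. F k) = F 0 + F 1 + F 2"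
    "(\<Sum>k\<le>3. F k) = F 0 + F 1 + F 2 + F 3"
    "(\<Sum>k\<le>4. F k) = F 0 + F 1 + F 2 + F 3 + F 4"
    "(\<Sum>k\<le>5. F k) = F 0 + F 1 + F 2 + F 3 + F 4 + F 5"
    "(\<Sum>k\<le>6. F k) = F 0 + F 1 + F 2 + F 3 + F 4 + F 5 + F 6"
  by (simp_all add: eval_nat_numeral)

lemma choose_values:
  "4 choose 2 = (6::nat)" "3 choose 2 = (3::nat)" "4 choose 3 = (4::nat)" "5 choose 2 = (10::nat)" "5 choose 3 = (10::nat)" "5 choose 4 = (5::nat)"
  "6 choose 2 = (15::nat)" "6 choose 3 = (20::nat)" "6 choose 4 = (15::nat)" "6 choose 5 = (6::nat)"
  by (simp_all add: eval_nat_numeral)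

text \<open>Moment form of the fact that variances of independent centred normal variables add.
  Degree six is the highest that occurs, so each degree is settled as a polynomial identity.\<close>

lemma normal_moment_add:
  assumes "n \<le> 6"
  shows "(\<Sum>k\<le>n. real (n choose k) * (normal_moment s k * normal_moment t (n - k))) = normal_moment (s + t) n"
proof -
  from assms consider "n = 0" | "n = 1" | "n = 2" | "n = 3" | "n = 4" | "n = 5" | "n = 6" by linarith
  then show ?thesis
    by cases (simp_all add: sum_atMost_values normal_moment_values[unfolded One_nat_def] choose_values power2_eq_square
       power3_eq_cube algebra_simps)
qed

text \<open>Degrees of freedom add: a Vandermonde identity for rising products with step 2. Degree
  five, the tenth moment of a norm, suffices to control the ninth.\<close>

lemma chi2_moment_add:
  assumes "n \<le> 5"
  shows "(\<Sum>k\<le>n. real (n choose k) * (chi2_moment m k * chi2_moment l (n - k))) = chi2_moment (m + l) n"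
proof -
  from assms consider "n = 0" | "n = 1" | "n = 2" | "n = 3" | "n = 4" | "n = 5" by linarith
  then show ?thesis
    by cases (simp_all add: sum_atMost_values chi2_moment_values[unfolded One_nat_def] choose_values algebra_simps)
qed

lemma chi2_moment_one:
  assumes "n \<le> 5"
  shows "fact (2 * n) / (2 ^ n * fact n) = chi2_moment 1 n"
proof -
  from assms consider "n = 0" | "n = 1" | "n = 2" | "n = 3" | "n = 4" | "n = 5" by linarith
  then show ?thesis
    by cases (simp_all add: chi2_moment_values[unfolded One_nat_def] fact_numeral)
qed

section \<open>Closed moments of a Gaussian vector\<close>

context prob_space
begin

lemma gaussian_inner_moment:
  fixes X :: "'a \<Rightarrow> real ^ 'n"
  assumes X: "distributed M lborel X (\<lambda>v. ennreal (std_gaussian_density v))" and n: "n \<le> 6"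
  shows "has_bochner_integral M (\<lambda>\<omega>. (z \<bullet> X \<omega>) ^ n) (normal_moment (z \<bullet> z) n)"
proof -
  \<comment> \<open>Coordinates are added one by one. The degree stays arbitrary in the induction,
    since expanding the power for \<open>insert b J\<close> calls on all lower powers of the sum
    over \<open>J\<close>.\<close>
  have "has_bochner_integral M (\<lambda>\<omega>. (\<Sum>b\<in>J. (z \<bullet> b) * (X \<omega> \<bullet> b)) ^ n) (normal_moment (\<Sum>b\<in>J. (z \<bullet> b)\<^sup>2) n)"
    if "finite J" "J \<subseteq> Basis" "n \<le> 6" for J n
    using that
  proof (induction J arbitrary: n)
    case empty
    then show ?case
      by (cases "n = 0") (auto simp: normal_moment_def has_bochner_integral_iff prob_space power_0_left elim!: evenE)
  next
    case (insert b J)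
    have "indep_vars (\<lambda>_. borel) (\<lambda>b \<omega>. X \<omega> \<bullet> b) (insert b J)"
      using gaussian_coordinates_indep[OF X] insert.prems(1) by (rule indep_vars_subset)
    then have "indep_vars (\<lambda>_. borel) (\<lambda>b \<omega>. (z \<bullet> b) * (X \<omega> \<bullet> b)) (insert b J)"
      by (rule indep_vars_compose2[where Y="\<lambda>b x. (z \<bullet> b) * x"]) auto
    then have ind: "indep_var borel (\<lambda>\<omega>. (z \<bullet> b) * (X \<omega> \<bullet> b)) borel (\<lambda>\<omega>. \<Sum>b\<in>J. (z \<bullet> b) * (X \<omega> \<bullet> b))"
      using insert.hyps by (intro indep_vars_sum)
    have N: "distributed M lborel (\<lambda>\<omega>. X \<omega> \<bullet> b) (\<lambda>x. ennreal (std_normal_density x))"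
      using gaussian_coordinate_distr[OF X] insert.prems by auto
    have one: "has_bochner_integral M (\<lambda>\<omega>. ((z \<bullet> b) * (X \<omega> \<bullet> b)) ^ k) (normal_moment ((z \<bullet> b)\<^sup>2) k)" for k
    proof (cases "even k")
      case True
      then obtain j where "k = 2 * j" by blast
      then show ?thesis
        using has_bochner_integral_mult_right[OF std_normal_power_even[OF N, of j], of "(z \<bullet> b) ^ k"]
        by (simp add: normal_moment_def power_mult_distrib power_mult)
    next
      case False
      then obtain j where "k = 2 * j + 1" using oddE by blast
      then show ?thesis
        using has_bochner_integral_mult_right[OF std_normal_power_odd[OF N, of j], of "(z \<bullet> b) ^ k"]
        by (simp add: normal_moment_def power_mult_distrib mult_ac)
    qed
    have "has_bochner_integral M (\<lambda>\<omega>. ((z \<bullet> b) * (X \<omega> \<bullet> b) + (\<Sum>b\<in>J. (z \<bullet> b) * (X \<omega> \<bullet> b))) ^ n)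
       (\<Sum>k\<le>n. real (n choose k) * (normal_moment ((z \<bullet> b)\<^sup>2) k * normal_moment (\<Sum>b\<in>J. (z \<bullet> b)\<^sup>2) (n - k)))"
      using insert.prems by (intro has_bochner_integral_indep_sum_power[OF ind] one insert.IH) auto
    then show ?case
      using insert.hyps insert.prems by (simp add: normal_moment_add)
  qed
  from this[of Basis, OF _ _ n] show ?thesis
    unfolding euclidean_inner[of z "X _"] euclidean_inner[of z z] power2_eq_square by simp
qed

text \<open>The same induction with squared coordinates, each contributing one degree of
  freedom.\<close>

lemma gaussian_norm_moment:
  fixes X :: "'a \<Rightarrow> real ^ 'n"
  assumes X: "distributed M lborel X (\<lambda>v. ennreal (std_gaussian_density v))" and n: "n \<le> 5"
  shows "has_bochner_integral M (\<lambda>\<omega>. norm (X \<omega>) ^ (2 * n)) (chi2_moment (real CARD('n)) n)"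
proof -
  have "has_bochner_integral M (\<lambda>\<omega>. (\<Sum>b\<in>J. (X \<omega> \<bullet> b)\<^sup>2) ^ n) (chi2_moment (real (card J)) n)"
    if "finite J" "J \<subseteq> Basis" "n \<le> 5" for J n
    using that
  proof (induction J arbitrary: n)
    case empty
    then show ?case
      by (cases "n = 0") (auto simp: chi2_moment_def has_bochner_integral_iff prob_space lessThan_Suc_eq_insert_0 gr0_conv_Suc)
  next
    case (insert b J)
    have "indep_vars (\<lambda>_. borel) (\<lambda>b \<omega>. X \<omega> \<bullet> b) (insert b J)"
      using gaussian_coordinates_indep[OF X] insert.prems(1) by (rule indep_vars_subset)
    then have "indep_vars (\<lambda>_. borel) (\<lambda>b \<omega>. (X \<omega> \<bullet> b)\<^sup>2) (insert b J)"
      by (rule indep_vars_compose2[where Y="\<lambda>b x. x\<^sup>2"]) auto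
    then have ind: "indep_var borel (\<lambda>\<omega>. (X \<omega> \<bullet> b)\<^sup>2) borel (\<lambda>\<omega>. \<Sum>b\<in>J. (X \<omega> \<bullet> b)\<^sup>2)"
      using insert.hyps by (intro indep_vars_sum)
    have N: "distributed M lborel (\<lambda>\<omega>. X \<omega> \<bullet> b) (\<lambda>x. ennreal (std_normal_density x))"
      using gaussian_coordinate_distr[OF X] insert.prems by auto
    have one: "has_bochner_integral M (\<lambda>\<omega>. ((X \<omega> \<bullet> b)\<^sup>2) ^ k) (chi2_moment 1 k)" if "k \<le> 5" for k
      using std_normal_power_even[OF N, of k] chi2_moment_one[OF that] by (simp add: power_mult)
    have "has_bochner_integral M (\<lambda>\<omega>. ((X \<omega> \<bullet> b)\<^sup>2 + (\<Sum>b\<in>J. (X \<omega> \<bullet> b)\<^sup>2)) ^ n)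
       (\<Sum>k\<le>n. real (n choose k) * (chi2_moment 1 k * chi2_moment (real (card J)) (n - k)))"
      using insert.prems by (intro has_bochner_integral_indep_sum_power[OF ind] one insert.IH) auto
    then show ?case
      using insert.hyps insert.prems by (simp add: chi2_moment_add)
  qed
  note * = this[of Basis, OF _ _ n]
  have "norm v ^ (2 * n) = (\<Sum>b\<in>Basis. (v \<bullet> b)\<^sup>2) ^ n" for v :: "real ^ 'n"
    unfolding power_mult by (simp only: power2_norm_eq_inner euclidean_inner[of v v]) (simp add: power2_eq_square)
  with * show ?thesis
    by simp
qed

end

section \<open>Elementary inequalities for powers and means\<close>

lemma power_le_one_add_power:
  fixes x :: real
  assumes "0 \<le> x" "k \<le> n"
  shows "x ^ k \<le> 1 + x ^ n"
proof (cases "x \<le> 1")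
  case True
  with assms have "x ^ k \<le> 1" by (simp add: power_le_one)
  moreover have "0 \<le> x ^ n" using assms by simp
  ultimately show ?thesis by linarith
next
  case False
  then have "x ^ k \<le> x ^ n" using assms by (intro power_increasing) auto
  then show ?thesis by simp
qed

lemma cube_sum_le:
  fixes a b :: real
  assumes "0 \<le> a" "0 \<le> b"
  shows "(a + b) ^ 3 \<le> 4 * (a ^ 3 + b ^ 3)"
proof -
  have "0 \<le> 3 * (a + b) * (a - b)\<^sup>2" using assms by simp
  then show ?thesis by (simp add: power2_eq_square power3_eq_cube algebra_simps)
qed

text \<open>Jensen's inequality for the cube: on nonnegative reals it lies above its tangent at the
  mean \<open>m\<close>, and the linear part of the tangent sums to zero.\<close>

lemma cube_mean_le:
  fixes a :: "'i \<Rightarrow> real"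
  assumes I: "finite I" "I \<noteq> {}" and a: "\<And>i. i \<in> I \<Longrightarrow> 0 \<le> a i"
  shows "((\<Sum>i\<in>I. a i) / real (card I)) ^ 3 \<le> (\<Sum>i\<in>I. a i ^ 3) / real (card I)"
proof -
  define m where "m = (\<Sum>i\<in>I. a i) / real (card I)"
  have card: "0 < real (card I)" using I by (simp add: card_gt_0_iff)
  have m: "0 \<le> m" using a card by (simp add: m_def sum_nonneg)
  have "m ^ 3 + 3 * m\<^sup>2 * (a i - m) \<le> a i ^ 3" if "i \<in> I" for i
  proof -
    have "0 \<le> (a i - m)\<^sup>2 * (a i + 2 * m)" using a[OF that] m by simp
    then show ?thesis by (simp add: power2_eq_square power3_eq_cube algebra_simps)
  qed
  then have "(\<Sum>i\<in>I. m ^ 3 + 3 * m\<^sup>2 * (a i - m)) \<le> (\<Sum>i\<in>I. a i ^ 3)"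
    by (rule sum_mono)
  also have "(\<Sum>i\<in>I. m ^ 3 + 3 * m\<^sup>2 * (a i - m)) = real (card I) * m ^ 3 + 3 * m\<^sup>2 * ((\<Sum>i\<in>I. a i) - real (card I) * m)"
    by (simp add: sum.distrib sum_subtractf sum_distrib_left[symmetric])
  also have "(\<Sum>i\<in>I. a i) - real (card I) * m = 0"
    using card by (simp add: m_def)
  finally have "real (card I) * m ^ 3 \<le> (\<Sum>i\<in>I. a i ^ 3)" by simp
  then show ?thesis using card by (simp add: m_def[symmetric] field_simps)
qed

text \<open>Young's inequality with a free weight; the later choices of \<open>k\<close> decide how
  a product of random factors is shared between two closed moments.\<close>

lemma mult_le_weighted_squares:
  fixes a b k :: real
  assumes "0 < k"
  shows "a * b \<le> k * a\<^sup>2 + b\<^sup>2 / (4 * k)"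
proof -
  have "0 \<le> (2 * k * a - b)\<^sup>2 / (4 * k)" using assms by simp
  also have "\<dots> = k * a\<^sup>2 + b\<^sup>2 / (4 * k) - a * b"
    using assms by (simp add: power2_eq_square field_simps)
  finally show ?thesis by simp
qed

section \<open>Odd and mixed moments of a Gaussian vector\<close>

context prob_space
begin

text \<open>The tenth power is the highest even moment at hand; it dominates all lower powers, odd
  ones included.\<close>

lemma gaussian_norm_power_integrable:
  fixes X :: "'a \<Rightarrow> real ^ 'n"
  assumes X: "distributed M lborel X (\<lambda>v. ennreal (std_gaussian_density v))" and k: "k \<le> 10"
  shows "integrable M (\<lambda>\<omega>. norm (X \<omega>) ^ k)"
proof (rule Bochner_Integration.integrable_bound)
  have [measurable]: "X \<in> borel_measurable M"
    using distributed_measurable[OF X] by simp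
  show "integrable M (\<lambda>\<omega>. 1 + norm (X \<omega>) ^ 10)"
    using gaussian_norm_moment[OF X, of 5] by (auto simp: has_bochner_integral_iff)
  show "AE \<omega> in M. norm (norm (X \<omega>) ^ k) \<le> norm (1 + norm (X \<omega>) ^ 10)"
    using power_le_one_add_power[OF _ k, of "norm (X _)"] by (auto simp: abs_of_nonneg)
  show "(\<lambda>\<omega>. norm (X \<omega>) ^ k) \<in> borel_measurable M" by measurable
qed

text \<open>Polarization of the second moment: the covariance matrix is the identity.\<close>

lemma gaussian_inner_inner:
  fixes X :: "'a \<Rightarrow> real ^ 'n"
  assumes X: "distributed M lborel X (\<lambda>v. ennreal (std_gaussian_density v))"
  shows "has_bochner_integral M (\<lambda>\<omega>. (g \<bullet> X \<omega>) * (z \<bullet> X \<omega>)) (g \<bullet> z)"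
proof -
  have "has_bochner_integral M (\<lambda>\<omega>. (((g + z) \<bullet> X \<omega>)\<^sup>2 - ((g - z) \<bullet> X \<omega>)\<^sup>2) / 4)
      ((normal_moment ((g + z) \<bullet> (g + z)) 2 - normal_moment ((g - z) \<bullet> (g - z)) 2) / 4)"
    by (intro has_bochner_integral_divide_zero has_bochner_integral_diff gaussian_inner_moment[OF X]) auto
  moreover have "(((g + z) \<bullet> v)\<^sup>2 - ((g - z) \<bullet> v)\<^sup>2) / 4 = (g \<bullet> v) * (z \<bullet> v)" for v
    by (simp add: inner_add_left inner_diff_left power2_eq_square algebra_simps)
  moreover have "(normal_moment ((g + z) \<bullet> (g + z)) 2 - normal_moment ((g - z) \<bullet> (g - z)) 2) / 4 = g \<bullet> z"
    by (simp add: normal_moment_values inner_add_left inner_add_right inner_diff_left inner_diff_right inner_commute)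
  ultimately show ?thesis by simp
qed

text \<open>The ninth power is a fourth times a fifth power, so Young's inequality bounds it by the
  eighth and tenth moments. Any positive \<open>q\<close> with \<open>q * q\<close> at least
  \<open>d + 8\<close> would do; \<open>d + 110\<close> is the quantity that \<open>zo_error\<close>
  contains.\<close>

lemma gaussian_norm_power9_le:
  fixes X :: "'a \<Rightarrow> real ^ 'n"
  assumes X: "distributed M lborel X (\<lambda>v. ennreal (std_gaussian_density v))"
    and d: "d = real CARD('n)"
  shows "expectation (\<lambda>\<omega>. norm (X \<omega>) ^ 9) \<le> d * (d + 2) * (d + 4) * (d + 6) * sqrt (d + 110)"
proof -
  define q where "q = sqrt (d + 110)"
  have "0 \<le> d" by (simp add: d)
  then have q: "0 < q" "q * q = d + 110" by (auto simp: q_def)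
  note m8 = gaussian_norm_moment[OF X, of 4, folded d] and m10 = gaussian_norm_moment[OF X, of 5, folded d]
  have "expectation (\<lambda>\<omega>. norm (X \<omega>) ^ 9) \<le> expectation (\<lambda>\<omega>. q / 2 * norm (X \<omega>) ^ 8 + norm (X \<omega>) ^ 10 / (2 * q))"
  proof (intro integral_mono)
    show "integrable M (\<lambda>\<omega>. norm (X \<omega>) ^ 9)"
      by (rule gaussian_norm_power_integrable[OF X]) simp
    show "integrable M (\<lambda>\<omega>. q / 2 * norm (X \<omega>) ^ 8 + norm (X \<omega>) ^ 10 / (2 * q))"
      by (intro Bochner_Integration.integrable_add integrable_mult_right integrable_divide_zero
          gaussian_norm_power_integrable[OF X]) auto
    show "norm (X \<omega>) ^ 9 \<le> q / 2 * norm (X \<omega>) ^ 8 + norm (X \<omega>) ^ 10 / (2 * q)" for \<omega>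
      using mult_le_weighted_squares[of "q / 2" "norm (X \<omega>) ^ 4" "norm (X \<omega>) ^ 5"] q
      by (simp add: power_mult[symmetric] power_add[symmetric])
  qed
  also have "\<dots> = q / 2 * chi2_moment d 4 + chi2_moment d 5 / (2 * q)"
    using m8 m10 gaussian_norm_power_integrable[OF X, of 8] gaussian_norm_power_integrable[OF X, of 10]
    by (simp add: has_bochner_integral_iff)
  also have "\<dots> = d * (d + 2) * (d + 4) * (d + 6) * (q / 2 + (d + 8) / (2 * q))"
    by (simp add: chi2_moment_values algebra_simps add_divide_distrib)
  also have "\<dots> \<le> d * (d + 2) * (d + 4) * (d + 6) * q"
  proof (rule mult_left_mono)
    have "d + 8 \<le> q * q" by (simp add: q)
    then show "q / 2 + (d + 8) / (2 * q) \<le> q"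
      using q(1) by (simp add: field_simps)
  qed (use \<open>0 \<le> d\<close> in auto)
  finally show ?thesis by (simp add: q_def)
qed

text \<open>The exact value is \<open>(d + 2) * (norm g)\<^sup>2\<close>; splitting into two fourth
  moments costs a factor 2 but needs no joint moment.\<close>

lemma gaussian_inner_sq_norm_sq_le:
  fixes X :: "'a \<Rightarrow> real ^ 'n"
  assumes X: "distributed M lborel X (\<lambda>v. ennreal (std_gaussian_density v))"
    and d: "d = real CARD('n)"
  shows "integrable M (\<lambda>\<omega>. (g \<bullet> X \<omega>)\<^sup>2 * (norm (X \<omega>))\<^sup>2)"
    and "expectation (\<lambda>\<omega>. (g \<bullet> X \<omega>)\<^sup>2 * (norm (X \<omega>))\<^sup>2) \<le> 2 * (d + 2) * (norm g)\<^sup>2"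
proof -
  have Xm[measurable]: "X \<in> borel_measurable M"
    using distributed_measurable[OF X] by simp
  have d0: "0 \<le> d" by (simp add: d)
  have i4: "integrable M (\<lambda>\<omega>. norm (X \<omega>) ^ 4)"
    by (rule gaussian_norm_power_integrable[OF X]) simp
  show int: "integrable M (\<lambda>\<omega>. (g \<bullet> X \<omega>)\<^sup>2 * (norm (X \<omega>))\<^sup>2)"
  proof (rule Bochner_Integration.integrable_bound)
    show "integrable M (\<lambda>\<omega>. (norm g)\<^sup>2 * norm (X \<omega>) ^ 4)"
      using i4 by simp
    show "AE \<omega> in M. norm ((g \<bullet> X \<omega>)\<^sup>2 * (norm (X \<omega>))\<^sup>2) \<le> norm ((norm g)\<^sup>2 * norm (X \<omega>) ^ 4)"
    proof (intro AE_I2)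
      fix \<omega>
      have "(g \<bullet> X \<omega>)\<^sup>2 \<le> (norm g * norm (X \<omega>))\<^sup>2"
        using Cauchy_Schwarz_ineq2[of g "X \<omega>"] by (simp add: abs_le_square_iff[symmetric])
      then have "(g \<bullet> X \<omega>)\<^sup>2 * (norm (X \<omega>))\<^sup>2 \<le> (norm g * norm (X \<omega>))\<^sup>2 * (norm (X \<omega>))\<^sup>2"
        by (rule mult_right_mono) simp
      then show "norm ((g \<bullet> X \<omega>)\<^sup>2 * (norm (X \<omega>))\<^sup>2) \<le> norm ((norm g)\<^sup>2 * norm (X \<omega>) ^ 4)"
        by (simp add: power_mult_distrib power4_eq_xxxx power2_eq_square mult_ac)
    qed
  qed measurable
  show "expectation (\<lambda>\<omega>. (g \<bullet> X \<omega>)\<^sup>2 * (norm (X \<omega>))\<^sup>2) \<le> 2 * (d + 2) * (norm g)\<^sup>2"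
  proof (cases "g = 0")
    case False
    define N where "N = (norm g)\<^sup>2"
    have N: "0 < N" using False by (simp add: N_def)
    \<comment> \<open>A weight of order \<open>d / N\<close> makes both fourth-moment terms of order
      \<open>d * N\<close>; dividing by \<open>N\<close> is why \<open>g = 0\<close> is a separate
      case.\<close>
    define k where "k = (d + 2) / (2 * N)"
    have k: "0 < k" using N d0 by (simp add: k_def)
    note p4 = gaussian_inner_moment[OF X, of 4 g]
    have "expectation (\<lambda>\<omega>. (g \<bullet> X \<omega>)\<^sup>2 * (norm (X \<omega>))\<^sup>2)
        \<le> expectation (\<lambda>\<omega>. k * (g \<bullet> X \<omega>) ^ 4 + norm (X \<omega>) ^ 4 / (4 * k))"
    proof (intro integral_mono int)
      show "integrable M (\<lambda>\<omega>. k * (g \<bullet> X \<omega>) ^ 4 + norm (X \<omega>) ^ 4 / (4 * k))"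
        using p4 i4 by (auto simp: has_bochner_integral_iff)
      show "(g \<bullet> X \<omega>)\<^sup>2 * (norm (X \<omega>))\<^sup>2 \<le> k * (g \<bullet> X \<omega>) ^ 4 + norm (X \<omega>) ^ 4 / (4 * k)" for \<omega>
        using mult_le_weighted_squares[OF k, of "(g \<bullet> X \<omega>)\<^sup>2" "(norm (X \<omega>))\<^sup>2"]
        by (simp add: power_mult[symmetric])
    qed
    also have "\<dots> = k * (3 * N\<^sup>2) + d * (d + 2) / (4 * k)"
      using p4 i4 gaussian_norm_moment[OF X, of 2, folded d]
      by (simp add: has_bochner_integral_iff normal_moment_values chi2_moment_values N_def power2_norm_eq_inner)
    also have "\<dots> = (2 * d + 3) * N"
    proof -
      have *: "k * (3 * N\<^sup>2) = 3 * (d + 2) * N / 2" "d * (d + 2) / (4 * k) = d * N / 2"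
        using N d0 by (simp_all add: k_def field_simps power2_eq_square)
      show ?thesis unfolding * by (simp add: field_simps)
    qed
    also have "\<dots> \<le> 2 * (d + 2) * N"
      using N by (intro mult_right_mono) auto
    finally show ?thesis by (simp add: N_def)
  qed simp
qed

text \<open>The weight \<open>d powr (3 / 2)\<close> balances the sixth moments of \<open>g \<bullet> X\<close> and \<open>norm X\<close>.\<close>
lemma gaussian_inner_cube_norm_cube_le:
  fixes X :: "'a \<Rightarrow> real ^ 'n"
  assumes X: "distributed M lborel X (\<lambda>v. ennreal (std_gaussian_density v))"
    and d: "d = real CARD('n)"
  shows "integrable M (\<lambda>\<omega>. \<bar>g \<bullet> X \<omega>\<bar> ^ 3 * norm (X \<omega>) ^ 3)"
    and "d * sqrt d * expectation (\<lambda>\<omega>. \<bar>g \<bullet> X \<omega>\<bar> ^ 3 * norm (X \<omega>) ^ 3) \<le> 8 * (d + 2) ^ 3 * norm g ^ 3"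
proof -
  have Xm[measurable]: "X \<in> borel_measurable M"
    using distributed_measurable[OF X] by simp
  have d1: "1 \<le> d" by (simp add: d Suc_le_eq)
  have i6: "integrable M (\<lambda>\<omega>. norm (X \<omega>) ^ 6)"
    by (rule gaussian_norm_power_integrable[OF X]) simp
  show int: "integrable M (\<lambda>\<omega>. \<bar>g \<bullet> X \<omega>\<bar> ^ 3 * norm (X \<omega>) ^ 3)"
  proof (rule Bochner_Integration.integrable_bound)
    show "integrable M (\<lambda>\<omega>. norm g ^ 3 * norm (X \<omega>) ^ 6)"
      using i6 by simp
    show "AE \<omega> in M. norm (\<bar>g \<bullet> X \<omega>\<bar> ^ 3 * norm (X \<omega>) ^ 3) \<le> norm (norm g ^ 3 * norm (X \<omega>) ^ 6)"
    proof (intro AE_I2)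
      fix \<omega>
      have "\<bar>g \<bullet> X \<omega>\<bar> ^ 3 * norm (X \<omega>) ^ 3 \<le> (norm g * norm (X \<omega>)) ^ 3 * norm (X \<omega>) ^ 3"
        by (intro mult_right_mono power_mono Cauchy_Schwarz_ineq2) auto
      also have "\<dots> = norm g ^ 3 * norm (X \<omega>) ^ 6"
        by (simp add: power_mult_distrib power_add[symmetric])
      finally show "norm (\<bar>g \<bullet> X \<omega>\<bar> ^ 3 * norm (X \<omega>) ^ 3) \<le> norm (norm g ^ 3 * norm (X \<omega>) ^ 6)"
        by simp
    qed
  qed measurable
  show "d * sqrt d * expectation (\<lambda>\<omega>. \<bar>g \<bullet> X \<omega>\<bar> ^ 3 * norm (X \<omega>) ^ 3) \<le> 8 * (d + 2) ^ 3 * norm g ^ 3"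
  proof (cases "g = 0")
    case False
    define N where "N = norm g ^ 3"
    have N: "0 < N" using False by (simp add: N_def)
    define w where "w = d * sqrt d"
    have w: "0 < w" "w\<^sup>2 = d ^ 3" using d1 by (auto simp: w_def power_mult_distrib power2_eq_square power3_eq_cube)
    define k where "k = w / (2 * N)"
    have k: "0 < k" using N w by (simp add: k_def)
    note p6 = gaussian_inner_moment[OF X, of 6 g]
    have "expectation (\<lambda>\<omega>. \<bar>g \<bullet> X \<omega>\<bar> ^ 3 * norm (X \<omega>) ^ 3)
        \<le> expectation (\<lambda>\<omega>. k * (g \<bullet> X \<omega>) ^ 6 + norm (X \<omega>) ^ 6 / (4 * k))"
    proof (intro integral_mono int)
      show "integrable M (\<lambda>\<omega>. k * (g \<bullet> X \<omega>) ^ 6 + norm (X \<omega>) ^ 6 / (4 * k))"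
        using p6 i6 by (auto simp: has_bochner_integral_iff)
      show "\<bar>g \<bullet> X \<omega>\<bar> ^ 3 * norm (X \<omega>) ^ 3 \<le> k * (g \<bullet> X \<omega>) ^ 6 + norm (X \<omega>) ^ 6 / (4 * k)" for \<omega>
        using mult_le_weighted_squares[OF k, of "\<bar>g \<bullet> X \<omega>\<bar> ^ 3" "norm (X \<omega>) ^ 3"]
        by (simp add: power_mult[symmetric] power_even_abs_numeral)
    qed
    also have "\<dots> = k * (15 * N\<^sup>2) + d * (d + 2) * (d + 4) / (4 * k)"
      using p6 i6 gaussian_norm_moment[OF X, of 3, folded d]
      by (simp add: has_bochner_integral_iff normal_moment_values chi2_moment_values N_def power2_norm_eq_inner[symmetric]
          power_mult[symmetric])
    finally have "w * expectation (\<lambda>\<omega>. \<bar>g \<bullet> X \<omega>\<bar> ^ 3 * norm (X \<omega>) ^ 3)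
        \<le> w * (k * (15 * N\<^sup>2) + d * (d + 2) * (d + 4) / (4 * k))"
      using w by (intro mult_left_mono) auto
    also have "\<dots> = N * (15 * w\<^sup>2 + d * (d + 2) * (d + 4)) / 2"
      using N w(1) by (simp add: k_def field_simps power2_eq_square)
    also have "\<dots> \<le> N * (16 * (d + 2) ^ 3) / 2"
    proof (intro divide_right_mono mult_left_mono)
      show "15 * w\<^sup>2 + d * (d + 2) * (d + 4) \<le> 16 * (d + 2) ^ 3"
        using d1 by (simp add: w(2) power3_eq_cube algebra_simps)
    qed (use N in auto)
    finally show ?thesis by (simp add: N_def w_def mult_ac)
  qed simp
qed

end

subsection \<open>The mini-batch estimate\<close>

text \<open>One summand of the estimator before the outer factor \<open>W\<close> is applied. The
  remainder \<open>e\<close> stays abstract: the moment bounds use only its measurability and its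
  quadratic growth.\<close>

definition directional_estimate :: "'a::real_inner \<Rightarrow> ('a \<Rightarrow> real) \<Rightarrow> 'a \<Rightarrow> 'a" where
  "directional_estimate g e v = (g \<bullet> v + e v) *\<^sub>R v"

lemma borel_measurable_directional_estimate [measurable]:
  fixes e :: "'a::euclidean_space \<Rightarrow> real"
  assumes [measurable]: "e \<in> borel_measurable borel"
  shows "directional_estimate g e \<in> borel_measurable borel"
  unfolding directional_estimate_def[abs_def] by measurable

context prob_space
begin

text \<open>The linear part has mean exactly \<open>g \<bullet> z\<close>, so only the remainder
  biases. The weight stays free because it is used twice: 1/4 in the direction of the mean itself,
  and 1/8 in the direction \<open>g\<close>.\<close>

lemma directional_estimate_inner:
  fixes X :: "'a \<Rightarrow> real ^ 'n"
  assumes X: "distributed M lborel X (\<lambda>v. ennreal (std_gaussian_density v))"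
    and d: "d = real CARD('n)"
    and e[measurable]: "e \<in> borel_measurable borel" and ec: "\<And>v. \<bar>e v\<bar> \<le> c * (norm v)\<^sup>2"
  shows "integrable M (\<lambda>\<omega>. directional_estimate g e (X \<omega>) \<bullet> z)"
    and "0 < k \<Longrightarrow> \<bar>expectation (\<lambda>\<omega>. directional_estimate g e (X \<omega>) \<bullet> z) - g \<bullet> z\<bar>
      \<le> k * (norm z)\<^sup>2 + c\<^sup>2 * (d * (d + 2)) / (4 * k)"
proof -
  have Xm[measurable]: "X \<in> borel_measurable M"
    using distributed_measurable[OF X] by simp
  note z2 = gaussian_inner_moment[OF X, of 2 z] and r4 = gaussian_norm_moment[OF X, of 2, folded d]
  have bound: "\<bar>e v * (z \<bullet> v)\<bar> \<le> k * (z \<bullet> v)\<^sup>2 + c\<^sup>2 * norm v ^ 4 / (4 * k)" if "0 < k" for v k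
  proof -
    have "\<bar>e v * (z \<bullet> v)\<bar> = \<bar>z \<bullet> v\<bar> * \<bar>e v\<bar>" by (simp add: abs_mult)
    also have "\<dots> \<le> \<bar>z \<bullet> v\<bar> * (c * (norm v)\<^sup>2)" by (intro mult_left_mono ec) simp
    also have "\<dots> \<le> k * \<bar>z \<bullet> v\<bar>\<^sup>2 + (c * (norm v)\<^sup>2)\<^sup>2 / (4 * k)"
      by (rule mult_le_weighted_squares[OF that])
    finally show ?thesis by (simp add: power_mult_distrib power_mult[symmetric])
  qed
  have int: "has_bochner_integral M (\<lambda>\<omega>. k * (z \<bullet> X \<omega>)\<^sup>2 + c\<^sup>2 * norm (X \<omega>) ^ 4 / (4 * k))
      (k * (norm z)\<^sup>2 + c\<^sup>2 * (d * (d + 2)) / (4 * k))" for k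
    using has_bochner_integral_add[OF has_bochner_integral_mult_right[OF z2, of k]
        has_bochner_integral_divide_zero[OF has_bochner_integral_mult_right[OF r4, of "c\<^sup>2"], of "4 * k"]]
    by (simp add: normal_moment_values chi2_moment_values power2_norm_eq_inner)
  have ie: "integrable M (\<lambda>\<omega>. e (X \<omega>) * (z \<bullet> X \<omega>))"
  proof (rule Bochner_Integration.integrable_bound)
    show "integrable M (\<lambda>\<omega>. 1 * (z \<bullet> X \<omega>)\<^sup>2 + c\<^sup>2 * norm (X \<omega>) ^ 4 / (4 * 1))"
      using int[of 1] by (simp add: has_bochner_integral_iff)
    show "AE \<omega> in M. norm (e (X \<omega>) * (z \<bullet> X \<omega>)) \<le> norm (1 * (z \<bullet> X \<omega>)\<^sup>2 + c\<^sup>2 * norm (X \<omega>) ^ 4 / (4 * 1))"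
      using bound[of 1] by (intro AE_I2) (auto intro: order_trans[OF _ abs_ge_self])
  qed measurable
  have eq: "directional_estimate g e v \<bullet> z = (g \<bullet> v) * (z \<bullet> v) + e v * (z \<bullet> v)" for v
    by (simp add: directional_estimate_def inner_commute[of v z] distrib_right)
  note gz = gaussian_inner_inner[OF X, of g z]
  show "integrable M (\<lambda>\<omega>. directional_estimate g e (X \<omega>) \<bullet> z)"
    unfolding eq using gz ie by (auto simp: has_bochner_integral_iff)
  assume k: "0 < k"
  have "expectation (\<lambda>\<omega>. directional_estimate g e (X \<omega>) \<bullet> z) - g \<bullet> z = expectation (\<lambda>\<omega>. e (X \<omega>) * (z \<bullet> X \<omega>))"
    unfolding eq using gz ie by (auto simp: has_bochner_integral_iff)
  also have "\<bar>\<dots>\<bar> \<le> expectation (\<lambda>\<omega>. \<bar>e (X \<omega>) * (z \<bullet> X \<omega>)\<bar>)"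
    by (rule integral_abs_bound)
  also have "\<dots> \<le> expectation (\<lambda>\<omega>. k * (z \<bullet> X \<omega>)\<^sup>2 + c\<^sup>2 * norm (X \<omega>) ^ 4 / (4 * k))"
    using int[of k] ie bound[OF k] by (intro integral_mono) (auto simp: has_bochner_integral_iff)
  also have "\<dots> = k * (norm z)\<^sup>2 + c\<^sup>2 * (d * (d + 2)) / (4 * k)"
    using int[of k] by (simp add: has_bochner_integral_iff)
  finally show "\<bar>expectation (\<lambda>\<omega>. directional_estimate g e (X \<omega>) \<bullet> z) - g \<bullet> z\<bar>
      \<le> k * (norm z)\<^sup>2 + c\<^sup>2 * (d * (d + 2)) / (4 * k)" .
qed

text \<open>Splitting the square of \<open>g \<bullet> v + e v\<close> doubles the mixed moment
  bound \<open>2 * (d + 2)\<close>; the remainder contributes through the sixth moment of the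
  norm.\<close>

lemma directional_estimate_norm_sq:
  fixes X :: "'a \<Rightarrow> real ^ 'n"
  assumes X: "distributed M lborel X (\<lambda>v. ennreal (std_gaussian_density v))"
    and d: "d = real CARD('n)"
    and e[measurable]: "e \<in> borel_measurable borel" and ec: "\<And>v. \<bar>e v\<bar> \<le> c * (norm v)\<^sup>2"
  shows "integrable M (\<lambda>\<omega>. (norm (directional_estimate g e (X \<omega>)))\<^sup>2)"
    and "expectation (\<lambda>\<omega>. (norm (directional_estimate g e (X \<omega>)))\<^sup>2)
      \<le> 4 * (d + 2) * (norm g)\<^sup>2 + 2 * c\<^sup>2 * (d * (d + 2) * (d + 4))"
proof -
  have Xm[measurable]: "X \<in> borel_measurable M"
    using distributed_measurable[OF X] by simp
  note p = gaussian_inner_sq_norm_sq_le[OF X d, of g] and r6 = gaussian_norm_moment[OF X, of 3, folded d]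
  let ?B = "\<lambda>v. 2 * ((g \<bullet> v)\<^sup>2 * (norm v)\<^sup>2) + 2 * c\<^sup>2 * norm v ^ 6"
  have bound: "(norm (directional_estimate g e v))\<^sup>2 \<le> ?B v" for v
  proof -
    have "(e v)\<^sup>2 \<le> (c * (norm v)\<^sup>2)\<^sup>2"
      using ec[of v] by (simp add: abs_le_square_iff[symmetric])
    moreover have "(g \<bullet> v + e v)\<^sup>2 \<le> 2 * (g \<bullet> v)\<^sup>2 + 2 * (e v)\<^sup>2"
      using zero_le_power2[of "g \<bullet> v - e v"] by (simp add: power2_eq_square algebra_simps)
    ultimately have "(g \<bullet> v + e v)\<^sup>2 \<le> 2 * (g \<bullet> v)\<^sup>2 + 2 * (c * (norm v)\<^sup>2)\<^sup>2" by linarith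
    then have "(g \<bullet> v + e v)\<^sup>2 * (norm v)\<^sup>2 \<le> (2 * (g \<bullet> v)\<^sup>2 + 2 * (c * (norm v)\<^sup>2)\<^sup>2) * (norm v)\<^sup>2"
      by (rule mult_right_mono) simp
    also have "\<dots> = ?B v"
      by (simp add: power_mult_distrib power_mult[symmetric] distrib_right mult.assoc power_add[symmetric])
    finally show ?thesis by (simp add: directional_estimate_def power_mult_distrib)
  qed
  have intB: "integrable M (\<lambda>\<omega>. ?B (X \<omega>))"
    using p r6 by (auto simp: has_bochner_integral_iff)
  show int: "integrable M (\<lambda>\<omega>. (norm (directional_estimate g e (X \<omega>)))\<^sup>2)"
    using bound by (intro Bochner_Integration.integrable_bound[OF intB]) (auto intro: order_trans[OF _ abs_ge_self])
  have "expectation (\<lambda>\<omega>. (norm (directional_estimate g e (X \<omega>)))\<^sup>2) \<le> expectation (\<lambda>\<omega>. ?B (X \<omega>))"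
    by (intro integral_mono int intB bound)
  also have "\<dots> = 2 * expectation (\<lambda>\<omega>. (g \<bullet> X \<omega>)\<^sup>2 * (norm (X \<omega>))\<^sup>2) + 2 * c\<^sup>2 * (d * (d + 2) * (d + 4))"
    using p r6 by (simp add: has_bochner_integral_iff chi2_moment_values)
  also have "\<dots> \<le> 2 * (2 * (d + 2) * (norm g)\<^sup>2) + 2 * c\<^sup>2 * (d * (d + 2) * (d + 4))"
    by (intro add_right_mono mult_left_mono p) simp
  also have "\<dots> = 4 * (d + 2) * (norm g)\<^sup>2 + 2 * c\<^sup>2 * (d * (d + 2) * (d + 4))"
    by simp
  finally show "expectation (\<lambda>\<omega>. (norm (directional_estimate g e (X \<omega>)))\<^sup>2)
      \<le> 4 * (d + 2) * (norm g)\<^sup>2 + 2 * c\<^sup>2 * (d * (d + 2) * (d + 4))" .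
qed

text \<open>The remainder is quadratic in \<open>norm v\<close> and multiplies \<open>v\<close>, so
  its cube has degree nine: this is where the ninth moment enters.\<close>

lemma directional_estimate_norm_cube:
  fixes X :: "'a \<Rightarrow> real ^ 'n"
  assumes X: "distributed M lborel X (\<lambda>v. ennreal (std_gaussian_density v))"
    and d: "d = real CARD('n)"
    and e[measurable]: "e \<in> borel_measurable borel" and ec: "\<And>v. \<bar>e v\<bar> \<le> c * (norm v)\<^sup>2" and c: "0 \<le> c"
  shows "integrable M (\<lambda>\<omega>. norm (directional_estimate g e (X \<omega>)) ^ 3)"
    and "expectation (\<lambda>\<omega>. norm (directional_estimate g e (X \<omega>)) ^ 3)
      \<le> 4 * (8 * (d + 2) ^ 3 * norm g ^ 3 / (d * sqrt d)
        + c ^ 3 * (d * (d + 2) * (d + 4) * (d + 6) * sqrt (d + 110)))"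
proof -
  have Xm[measurable]: "X \<in> borel_measurable M"
    using distributed_measurable[OF X] by simp
  note p = gaussian_inner_cube_norm_cube_le[OF X d, of g]
  have r9: "integrable M (\<lambda>\<omega>. norm (X \<omega>) ^ 9)"
    by (rule gaussian_norm_power_integrable[OF X]) simp
  let ?B = "\<lambda>v. 4 * (\<bar>g \<bullet> v\<bar> ^ 3 * norm v ^ 3 + c ^ 3 * norm v ^ 9)"
  have bound: "norm (directional_estimate g e v) ^ 3 \<le> ?B v" for v
  proof -
    have "norm (directional_estimate g e v) = \<bar>g \<bullet> v + e v\<bar> * norm v"
      by (simp add: directional_estimate_def)
    also have "\<dots> \<le> (\<bar>g \<bullet> v\<bar> + c * (norm v)\<^sup>2) * norm v"
      using ec[of v] by (intro mult_right_mono) auto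
    finally have "norm (directional_estimate g e v) ^ 3 \<le> (\<bar>g \<bullet> v\<bar> * norm v + c * (norm v)\<^sup>2 * norm v) ^ 3"
      by (intro power_mono) (auto simp: distrib_right)
    also have "\<dots> \<le> 4 * ((\<bar>g \<bullet> v\<bar> * norm v) ^ 3 + (c * (norm v)\<^sup>2 * norm v) ^ 3)"
      using c by (intro cube_sum_le) auto
    also have "\<dots> = ?B v"
      by (simp add: power_mult_distrib power_mult[symmetric] mult.assoc power_add[symmetric])
    finally show ?thesis .
  qed
  have intB: "integrable M (\<lambda>\<omega>. ?B (X \<omega>))"
    using p r9 by auto
  show int: "integrable M (\<lambda>\<omega>. norm (directional_estimate g e (X \<omega>)) ^ 3)"
    using bound by (intro Bochner_Integration.integrable_bound[OF intB]) (auto intro: order_trans[OF _ abs_ge_self])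
  have d0: "0 < d * sqrt d" by (simp add: d)
  have "expectation (\<lambda>\<omega>. norm (directional_estimate g e (X \<omega>)) ^ 3) \<le> expectation (\<lambda>\<omega>. ?B (X \<omega>))"
    by (intro integral_mono int intB bound)
  also have "\<dots> = 4 * (expectation (\<lambda>\<omega>. \<bar>g \<bullet> X \<omega>\<bar> ^ 3 * norm (X \<omega>) ^ 3) + c ^ 3 * expectation (\<lambda>\<omega>. norm (X \<omega>) ^ 9))"
    using p r9 by simp
  also have "\<dots> \<le> 4 * (8 * (d + 2) ^ 3 * norm g ^ 3 / (d * sqrt d)
        + c ^ 3 * (d * (d + 2) * (d + 4) * (d + 6) * sqrt (d + 110)))"
    using p(2) d0 c by (intro mult_left_mono add_mono gaussian_norm_power9_le[OF X d])
      (simp_all add: pos_le_divide_eq mult_ac)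
  finally show "expectation (\<lambda>\<omega>. norm (directional_estimate g e (X \<omega>)) ^ 3)
      \<le> 4 * (8 * (d + 2) ^ 3 * norm g ^ 3 / (d * sqrt d)
        + c ^ 3 * (d * (d + 2) * (d + 4) * (d + 6) * sqrt (d + 110)))" .
qed

end

definition batch_estimate :: "nat \<Rightarrow> 'a::real_inner \<Rightarrow> ('a \<Rightarrow> real) \<Rightarrow> (nat \<Rightarrow> 'a) \<Rightarrow> 'a" where
  "batch_estimate b g e u = (1 / real b) *\<^sub>R (\<Sum>i=1..b. directional_estimate g e (u i))"

locale gaussian_batch = prob_space M for M :: "'w measure" +
  fixes u :: "nat \<Rightarrow> 'w \<Rightarrow> real ^ 'n" and b :: nat and e :: "real ^ 'n \<Rightarrow> real" and c d :: real
  assumes b: "1 \<le> b"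
    and indep: "indep_vars (\<lambda>_. borel) u {1..b}"
    and gaussian: "\<And>i. i \<in> {1..b} \<Longrightarrow> distributed M lborel (u i) (\<lambda>v. ennreal (std_gaussian_density v))"
    and d: "d = real CARD('n)"
    and e_measurable [measurable]: "e \<in> borel_measurable borel"
    and e_le: "\<And>v. \<bar>e v\<bar> \<le> c * (norm v)\<^sup>2"
begin

lemma u_measurable [measurable]: "i \<in> {1..b} \<Longrightarrow> u i \<in> borel_measurable M"
  using distributed_measurable[OF gaussian] by simp

abbreviation Y :: "real ^ 'n \<Rightarrow> nat \<Rightarrow> 'w \<Rightarrow> real ^ 'n" where
  "Y g i \<omega> \<equiv> directional_estimate g e (u i \<omega>)"

abbreviation G :: "real ^ 'n \<Rightarrow> 'w \<Rightarrow> real ^ 'n" where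
  "G g \<omega> \<equiv> batch_estimate b g e (\<lambda>i. u i \<omega>)"

lemma G_measurable [measurable]: "G g \<in> borel_measurable M"
  unfolding batch_estimate_def by measurable

lemma expectation_G_inner:
  shows "integrable M (\<lambda>\<omega>. G g \<omega> \<bullet> z)"
    and "0 < k \<Longrightarrow> \<bar>expectation (\<lambda>\<omega>. G g \<omega> \<bullet> z) - g \<bullet> z\<bar> \<le> k * (norm z)\<^sup>2 + c\<^sup>2 * (d * (d + 2)) / (4 * k)"
proof -
  note inner = directional_estimate_inner[OF gaussian d e_measurable e_le]
  have eq: "G g \<omega> \<bullet> z = (\<Sum>i=1..b. Y g i \<omega> \<bullet> z) / real b" for \<omega>
    by (simp add: batch_estimate_def inner_sum_left)
  show "integrable M (\<lambda>\<omega>. G g \<omega> \<bullet> z)"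
    unfolding eq by (intro integrable_divide_zero Bochner_Integration.integrable_sum inner(1))
  assume k: "0 < k"
  let ?R = "k * (norm z)\<^sup>2 + c\<^sup>2 * (d * (d + 2)) / (4 * k)"
  have "expectation (\<lambda>\<omega>. G g \<omega> \<bullet> z) - g \<bullet> z = (\<Sum>i=1..b. expectation (\<lambda>\<omega>. Y g i \<omega> \<bullet> z) - g \<bullet> z) / real b"
    unfolding eq integral_divide_zero using b
    by (subst Bochner_Integration.integral_sum[OF inner(1)]) (auto simp: sum_subtractf diff_divide_distrib)
  also have "\<bar>\<dots>\<bar> \<le> (\<Sum>i=1..b. ?R) / real b"
    unfolding abs_divide abs_of_nat using inner(2)[OF _ k, of _ g z]
    by (intro divide_right_mono order_trans[OF sum_abs] sum_mono) auto
  also have "\<dots> = ?R" using b by simp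
  finally show "\<bar>expectation (\<lambda>\<omega>. G g \<omega> \<bullet> z) - g \<bullet> z\<bar> \<le> ?R" .
qed

text \<open>The summands are independent with a common mean \<open>m\<close>, so distinct ones have
  inner product \<open>(norm m)\<^sup>2\<close> on average. The bias moves \<open>m\<close> away
  from \<open>g\<close>, but its size stays comparable.\<close>

lemma expectation_Y_inner_Y:
  "\<exists>m :: real ^ 'n. (norm m)\<^sup>2 \<le> 2 * (norm g)\<^sup>2 + 2 * c\<^sup>2 * (d * (d + 2)) \<and>
    (\<forall>i\<in>{1..b}. \<forall>j\<in>{1..b}. i \<noteq> j \<longrightarrow> has_bochner_integral M (\<lambda>\<omega>. Y g i \<omega> \<bullet> Y g j \<omega>) ((norm m)\<^sup>2))"
proof -
  note inner = directional_estimate_inner[OF gaussian d e_measurable e_le]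
  \<comment> \<open>Written with the density rather than with some \<open>u i\<close>, the mean is
    visibly the same for all samples.\<close>
  define m where "m = (\<Sum>a\<in>Basis. (\<integral>v. std_gaussian_density v * (directional_estimate g e v \<bullet> a) \<partial>lborel) *\<^sub>R (a :: real ^ 'n))"
  have Ya: "expectation (\<lambda>\<omega>. Y g i \<omega> \<bullet> a) = m \<bullet> a" if "a \<in> Basis" "i \<in> {1..b}" for a i
    using that distributed_integral[OF gaussian[OF that(2)], of "\<lambda>v. directional_estimate g e v \<bullet> a"]
    by (simp add: m_def std_gaussian_density_nonneg)
  have Ym: "expectation (\<lambda>\<omega>. Y g i \<omega> \<bullet> m) = (norm m)\<^sup>2" if "i \<in> {1..b}" for i
  proof -
    have "expectation (\<lambda>\<omega>. Y g i \<omega> \<bullet> m) = expectation (\<lambda>\<omega>. \<Sum>a\<in>Basis. (Y g i \<omega> \<bullet> a) * (m \<bullet> a))"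
      by (intro Bochner_Integration.integral_cong refl euclidean_inner)
    also have "\<dots> = (\<Sum>a\<in>Basis. (m \<bullet> a) * (m \<bullet> a))"
      by (subst Bochner_Integration.integral_sum) (auto simp: Ya[OF _ that] intro!: inner(1)[OF that] sum.cong)
    also have "\<dots> = (norm m)\<^sup>2" unfolding power2_norm_eq_inner by (rule euclidean_inner[symmetric])
    finally show ?thesis .
  qed
  have "1 \<in> {1..b}" using b by simp
  \<comment> \<open>The bias bound is tested in the direction \<open>m\<close> itself. Its weight
    1/4 and the Young step that follows each produce a quarter of \<open>(norm m)\<^sup>2\<close>,
    and the resulting half is absorbed on the left.\<close>
  from inner(2)[OF this, of "1 / 4" g m] Ym[OF this]
  have "(norm m)\<^sup>2 \<le> g \<bullet> m + (norm m)\<^sup>2 / 4 + c\<^sup>2 * (d * (d + 2))" by (simp add: abs_le_iff)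
  also have "g \<bullet> m \<le> (norm g)\<^sup>2 + (norm m)\<^sup>2 / 4"
    using order_trans[OF norm_cauchy_schwarz mult_le_weighted_squares[of 1 "norm g" "norm m"]] by simp
  finally have "(norm m)\<^sup>2 \<le> 2 * (norm g)\<^sup>2 + 2 * c\<^sup>2 * (d * (d + 2))" by simp
  moreover have "has_bochner_integral M (\<lambda>\<omega>. Y g i \<omega> \<bullet> Y g j \<omega>) ((norm m)\<^sup>2)"
    if ij: "i \<in> {1..b}" "j \<in> {1..b}" "i \<noteq> j" for i j
  proof -
    have "indep_var borel (u i) borel (u j)"
      using indep_var_compose[OF indep_var_restrict[OF indep, of "{i}" "{j}"], of "\<lambda>f. f i" borel "\<lambda>f. f j" borel] ij
      by (simp add: comp_def)
    have "has_bochner_integral M (\<lambda>\<omega>. (Y g i \<omega> \<bullet> a) * (Y g j \<omega> \<bullet> a)) ((m \<bullet> a) * (m \<bullet> a))" if a: "a \<in> Basis" for a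
    proof (rule has_bochner_integral_indep_mult)
      show "indep_var borel (\<lambda>\<omega>. Y g i \<omega> \<bullet> a) borel (\<lambda>\<omega>. Y g j \<omega> \<bullet> a)"
        using indep_var_compose[OF \<open>indep_var borel (u i) borel (u j)\<close>, of "\<lambda>v. directional_estimate g e v \<bullet> a" borel
            "\<lambda>v. directional_estimate g e v \<bullet> a" borel]
        by (simp add: comp_def)
    qed (use Ya a ij inner(1) in \<open>auto simp: has_bochner_integral_iff\<close>)
    then have "has_bochner_integral M (\<lambda>\<omega>. \<Sum>a\<in>Basis. (Y g i \<omega> \<bullet> a) * (Y g j \<omega> \<bullet> a)) (\<Sum>a\<in>Basis. (m \<bullet> a) * (m \<bullet> a))"
      by (intro has_bochner_integral_sum)
    then show "has_bochner_integral M (\<lambda>\<omega>. Y g i \<omega> \<bullet> Y g j \<omega>) ((norm m)\<^sup>2)"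
      by (simp only: euclidean_inner[symmetric] power2_norm_eq_inner)
  qed
  ultimately show ?thesis by blast
qed

text \<open>Of the \<open>b\<^sup>2\<close> inner products only the \<open>b\<close> diagonal ones
  carry the large second moment, so division by \<open>b\<^sup>2\<close> leaves it with a factor
  \<open>1 / b\<close>.\<close>

lemma expectation_G_norm_sq:
  shows "integrable M (\<lambda>\<omega>. (norm (G g \<omega>))\<^sup>2)"
    and "expectation (\<lambda>\<omega>. (norm (G g \<omega>))\<^sup>2)
      \<le> (4 * (d + 2) * (norm g)\<^sup>2 + 2 * c\<^sup>2 * (d * (d + 2) * (d + 4))) / real b
        + (2 * (norm g)\<^sup>2 + 2 * c\<^sup>2 * (d * (d + 2)))"
proof -
  obtain m :: "real ^ 'n" where m: "(norm m)\<^sup>2 \<le> 2 * (norm g)\<^sup>2 + 2 * c\<^sup>2 * (d * (d + 2))"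
    and ij: "\<And>i j. i \<in> {1..b} \<Longrightarrow> j \<in> {1..b} \<Longrightarrow> i \<noteq> j \<Longrightarrow> has_bochner_integral M (\<lambda>\<omega>. Y g i \<omega> \<bullet> Y g j \<omega>) ((norm m)\<^sup>2)"
    using expectation_Y_inner_Y by blast
  note sq = directional_estimate_norm_sq[OF gaussian d e_measurable e_le, of _ g]
  let ?B = "4 * (d + 2) * (norm g)\<^sup>2 + 2 * c\<^sup>2 * (d * (d + 2) * (d + 4))"
  have eq: "(norm (G g \<omega>))\<^sup>2 = (\<Sum>i=1..b. \<Sum>j=1..b. Y g j \<omega> \<bullet> Y g i \<omega>) / (real b)\<^sup>2" for \<omega>
    unfolding power2_norm_eq_inner batch_estimate_def
    by (simp add: inner_sum_left inner_sum_right power2_eq_square sum_divide_distrib)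
  have int: "integrable M (\<lambda>\<omega>. Y g i \<omega> \<bullet> Y g j \<omega>)" if "i \<in> {1..b}" "j \<in> {1..b}" for i j
    using ij[OF that] sq(1)[OF that(1)] by (cases "i = j") (auto simp: has_bochner_integral_iff power2_norm_eq_inner)
  show "integrable M (\<lambda>\<omega>. (norm (G g \<omega>))\<^sup>2)"
    unfolding eq by (intro integrable_divide_zero Bochner_Integration.integrable_sum int)
  have "expectation (\<lambda>\<omega>. (norm (G g \<omega>))\<^sup>2) = (\<Sum>i=1..b. \<Sum>j=1..b. expectation (\<lambda>\<omega>. Y g j \<omega> \<bullet> Y g i \<omega>)) / (real b)\<^sup>2"
    unfolding eq integral_divide_zero
    by (simp only: Bochner_Integration.integral_sum[OF Bochner_Integration.integrable_sum[OF int]]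
        Bochner_Integration.integral_sum[OF int] cong: sum.cong)
  also have "\<dots> \<le> (\<Sum>i=1..b. \<Sum>j=1..b. (if i = j then ?B else 0) + (norm m)\<^sup>2) / (real b)\<^sup>2"
  proof (intro divide_right_mono sum_mono)
    fix i j assume "i \<in> {1..b}" "j \<in> {1..b}"
    \<comment> \<open>Off the diagonal \<open>(norm m)\<^sup>2\<close> is the exact value; on it the
      term is added slack that makes the sum uniform.\<close>
    then show "expectation (\<lambda>\<omega>. Y g j \<omega> \<bullet> Y g i \<omega>) \<le> (if i = j then ?B else 0) + (norm m)\<^sup>2"
      using ij[of j i] sq(2)[of i] by (cases "i = j") (auto simp: has_bochner_integral_iff power2_norm_eq_inner add_increasing2)
  qed simp
  also have "\<dots> = (real b * ?B + (real b)\<^sup>2 * (norm m)\<^sup>2) / (real b)\<^sup>2"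
    by (rule arg_cong[where f="\<lambda>x. x / (real b)\<^sup>2"])
      (simp add: sum.distrib power2_eq_square algebra_simps)
  also have "\<dots> = ?B / real b + (norm m)\<^sup>2"
  proof -
    have *: "(r * x + r\<^sup>2 * y) / r\<^sup>2 = x / r + y" if "0 < r" for r x y :: real
      using that by (simp add: field_simps power2_eq_square)
    show ?thesis by (rule *) (use b in simp)
  qed
  also have "\<dots> \<le> ?B / real b + (2 * (norm g)\<^sup>2 + 2 * c\<^sup>2 * (d * (d + 2)))"
    using m by simp
  finally show "expectation (\<lambda>\<omega>. (norm (G g \<omega>))\<^sup>2) \<le> ?B / real b + (2 * (norm g)\<^sup>2 + 2 * c\<^sup>2 * (d * (d + 2)))" .
qed

text \<open>Convexity alone passes the bound for one sample to the mean. No gain from averaging is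
  sought, because the cubic term of the descent is already small.\<close>

lemma expectation_G_norm_cube:
  assumes c: "0 \<le> c"
  shows "integrable M (\<lambda>\<omega>. norm (G g \<omega>) ^ 3)"
    and "expectation (\<lambda>\<omega>. norm (G g \<omega>) ^ 3)
      \<le> 4 * (8 * (d + 2) ^ 3 * norm g ^ 3 / (d * sqrt d)
        + c ^ 3 * (d * (d + 2) * (d + 4) * (d + 6) * sqrt (d + 110)))"
proof -
  note cube = directional_estimate_norm_cube[OF gaussian d e_measurable e_le c, of _ g]
  have le: "norm (G g \<omega>) ^ 3 \<le> (\<Sum>i=1..b. norm (Y g i \<omega>) ^ 3) / real b" for \<omega>
  proof -
    have "norm (G g \<omega>) \<le> (\<Sum>i=1..b. norm (Y g i \<omega>)) / real b"
      by (simp add: batch_estimate_def divide_right_mono norm_sum)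
    then have "norm (G g \<omega>) ^ 3 \<le> ((\<Sum>i=1..b. norm (Y g i \<omega>)) / real b) ^ 3"
      by (intro power_mono) auto
    also have "\<dots> \<le> (\<Sum>i=1..b. norm (Y g i \<omega>) ^ 3) / real b"
      using cube_mean_le[of "{1..b}" "\<lambda>i. norm (Y g i \<omega>)"] b by simp
    finally show ?thesis .
  qed
  have intB: "integrable M (\<lambda>\<omega>. (\<Sum>i=1..b. norm (Y g i \<omega>) ^ 3) / real b)"
    by (intro integrable_divide_zero Bochner_Integration.integrable_sum cube(1))
  show int: "integrable M (\<lambda>\<omega>. norm (G g \<omega>) ^ 3)"
    using le by (intro Bochner_Integration.integrable_bound[OF intB] AE_I2)
      (auto intro!: order_trans[OF _ abs_ge_self] simp del: abs_divide)
  let ?B = "4 * (8 * (d + 2) ^ 3 * norm g ^ 3 / (d * sqrt d)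
        + c ^ 3 * (d * (d + 2) * (d + 4) * (d + 6) * sqrt (d + 110)))"
  have "expectation (\<lambda>\<omega>. norm (G g \<omega>) ^ 3) \<le> expectation (\<lambda>\<omega>. (\<Sum>i=1..b. norm (Y g i \<omega>) ^ 3) / real b)"
    by (intro integral_mono int intB le)
  also have "\<dots> = (\<Sum>i=1..b. expectation (\<lambda>\<omega>. norm (Y g i \<omega>) ^ 3)) / real b"
    unfolding integral_divide_zero by (subst Bochner_Integration.integral_sum[OF cube(1)]) auto
  also have "\<dots> \<le> (\<Sum>i=1..b. ?B) / real b"
    using cube(2) by (intro divide_right_mono sum_mono) auto
  also have "\<dots> = ?B" using b by simp
  finally show "expectation (\<lambda>\<omega>. norm (G g \<omega>) ^ 3) \<le> ?B" .
qed

end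

subsection \<open>The inverse square root of a positive definite matrix\<close>

lemma symmetric_inner_mult:
  fixes A :: "real ^ 'n ^ 'n"
  assumes "transpose A = A"
  shows "x \<bullet> (A *v y) = (A *v x) \<bullet> y"
  by (metis assms dot_lmul_matrix vector_transpose_matrix)

lemma symmetric_matrix_iff:
  fixes A :: "real ^ 'n ^ 'n"
  shows "transpose A = A \<longleftrightarrow> (\<forall>x y. x \<bullet> (A *v y) = (A *v x) \<bullet> y)"
proof
  assume *: "\<forall>x y. x \<bullet> (A *v y) = (A *v x) \<bullet> y"
  have "A $ i $ j = A $ j $ i" for i j
  proof -
    have "axis i 1 \<bullet> (A *v axis j 1) = (A *v axis i 1) \<bullet> axis j 1"
      using * by blast
    then show ?thesis
      by (simp add: matrix_vector_mult_basis column_def inner_axis inner_axis')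
  qed
  then show "transpose A = A"
    by (simp add: transpose_def vec_eq_iff)
qed (simp add: symmetric_inner_mult)

text \<open>Nonnegativity of the form at \<open>v - a *\<^sub>R T v\<close> with
  \<open>a = 1 / q\<close> turns a bound on the form into a bound on the operator.\<close>

lemma norm_le_of_quadratic_form_le:
  fixes T :: "'a::real_inner \<Rightarrow> 'a"
  assumes T: "linear T" and sym: "\<And>v w. v \<bullet> T w = T v \<bullet> w"
    and nonneg: "\<And>v. 0 \<le> v \<bullet> T v" and upper: "\<And>v. v \<bullet> T v \<le> q * (norm v)\<^sup>2" and q: "0 \<le> q"
  shows "norm (T v) \<le> q * norm v"
proof -
  define w where "w = T v"
  have key: "2 * a * (norm w)\<^sup>2 \<le> q * (norm v)\<^sup>2 + a\<^sup>2 * (q * (norm w)\<^sup>2)" for a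
  proof -
    have "0 \<le> (v - a *\<^sub>R w) \<bullet> T (v - a *\<^sub>R w)" by (rule nonneg)
    also have "\<dots> = v \<bullet> T v - 2 * a * (w \<bullet> w) + a\<^sup>2 * (w \<bullet> T w)"
      using sym[of v w] by (simp add: linear_diff[OF T] linear_scale[OF T] inner_diff_left inner_diff_right
          w_def[symmetric] power2_eq_square algebra_simps)
    also have "\<dots> \<le> q * (norm v)\<^sup>2 - 2 * a * (norm w)\<^sup>2 + a\<^sup>2 * (q * (norm w)\<^sup>2)"
      using upper[of v] mult_left_mono[OF upper[of w], of "a\<^sup>2"] by (simp add: power2_norm_eq_inner)
    finally show ?thesis by simp
  qed
  show ?thesis
  proof (cases "q = 0")
    case True
    with key[of 1] have "w = 0" by simp
    then show ?thesis using True by (simp add: w_def)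
  next
    case False
    with q have "0 < q" by simp
    with key[of "1 / q"] have "(norm w)\<^sup>2 \<le> (q * norm v)\<^sup>2"
      by (simp add: field_simps power2_eq_square)
    then show ?thesis
      using q by (simp add: w_def abs_le_square_iff[symmetric])
  qed
qed

text \<open>Such a \<open>v\<close> minimizes the form, and moving slightly along
  \<open>- T v\<close> would make it negative unless \<open>T v = 0\<close>.\<close>

lemma quadratic_form_eq_0_imp:
  fixes T :: "'a::real_inner \<Rightarrow> 'a"
  assumes T: "linear T" and sym: "\<And>v w. v \<bullet> T w = T v \<bullet> w"
    and nonneg: "\<And>v. 0 \<le> v \<bullet> T v" and zero: "v \<bullet> T v = 0"
  shows "T v = 0"
proof -
  define w k where "w = T v" and "k = w \<bullet> T w"
  have k: "0 \<le> k" by (simp add: k_def nonneg)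
  \<comment> \<open>A step short enough that the quadratic term takes back at most half of the
    first-order decrease; the \<open>1\<close> guards against \<open>k = 0\<close>.\<close>
  define a where "a = (norm w)\<^sup>2 / (k + 1)"
  have vT: "v \<bullet> T w = (norm w)\<^sup>2"
    by (simp add: sym w_def power2_norm_eq_inner)
  have "0 \<le> (v - a *\<^sub>R w) \<bullet> T (v - a *\<^sub>R w)" by (rule nonneg)
  also have "\<dots> = - 2 * a * (norm w)\<^sup>2 + a\<^sup>2 * k"
    using vT zero by (simp add: linear_diff[OF T] linear_scale[OF T] inner_diff_left inner_diff_right
        w_def[symmetric] k_def power2_eq_square[of a] power2_norm_eq_inner[symmetric] inner_commute[of w v] algebra_simps)
  also have "\<dots> = a * (a * k - 2 * (norm w)\<^sup>2)"
    by (simp add: power2_eq_square algebra_simps)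
  also have "\<dots> \<le> a * (- (norm w)\<^sup>2)"
  proof (rule mult_left_mono)
    have "a * k \<le> (norm w)\<^sup>2"
      using k by (simp add: a_def field_simps)
    then show "a * k - 2 * (norm w)\<^sup>2 \<le> - (norm w)\<^sup>2" by simp
  qed (use k in \<open>simp add: a_def\<close>)
  finally have "norm w ^ 4 \<le> 0"
    using k by (simp add: a_def divide_le_0_iff power2_eq_square power4_eq_xxxx mult.assoc)
  then have "w = 0" by simp
  then show ?thesis by (simp add: w_def)
qed

text \<open>With \<open>B = 1 - H / t\<close> of norm below 1, the square root is \<open>sqrt t (1 - Y)\<close>, where \<open>Y\<close> is the fixed
  point of the contraction \<open>Y \<mapsto> (B + Y\<^sup>2) / 2\<close>.\<close>
lemma psd_sqrt_exists:
  fixes H :: "real ^ 'n ^ 'n"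
  assumes sym: "transpose H = H" and \<zeta>: "0 < \<zeta>" and lower: "\<And>v. \<zeta> * (norm v)\<^sup>2 \<le> v \<bullet> (H *v v)"
  shows "\<exists>S. psd S \<and> S ** S = H"
proof -
  define t where "t = onorm ((*v) H) + \<zeta>"
  have bl: "bounded_linear ((*v) H)" by simp
  have t: "\<zeta> \<le> t" "0 < t"
    using onorm_pos_le[OF bl] \<zeta> by (auto simp: t_def)
  have upper: "v \<bullet> (H *v v) \<le> t * (norm v)\<^sup>2" for v
  proof -
    have "v \<bullet> (H *v v) \<le> norm v * norm (H *v v)" by (rule norm_cauchy_schwarz)
    also have "\<dots> \<le> norm v * (onorm ((*v) H) * norm v)"
      by (intro mult_left_mono onorm[OF bl]) auto
    also have "\<dots> \<le> t * (norm v)\<^sup>2"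
      using \<zeta> by (simp add: t_def power2_eq_square algebra_simps)
    finally show ?thesis .
  qed
  define q where "q = 1 - \<zeta> / t"
  \<comment> \<open>The smaller root of \<open>r * r - 2 * r + q = 0\<close>, hence the radius of a
    ball that the iteration maps into itself.\<close>
  define r where "r = 1 - sqrt (1 - q)"
  have q: "0 \<le> q" "q < 1"
    using t \<zeta> by (auto simp: q_def)
  have r: "0 \<le> r" "r < 1" and r2: "q + r * r = 2 * r"
    using q by (auto simp: r_def algebra_simps)
  define B where "B = Blinfun (\<lambda>v. v - (1 / t) *\<^sub>R (H *v v))"
  have B: "blinfun_apply B v = v - (1 / t) *\<^sub>R (H *v v)" for v
    unfolding B_def by (subst bounded_linear_Blinfun_apply) (auto intro!: bounded_linear_intros)
  have B_sym: "v \<bullet> B w = B v \<bullet> w" for v w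
    using symmetric_inner_mult[OF sym, of v w] by (simp add: B inner_diff_left inner_diff_right)
  have "norm (B v) \<le> q * norm v" for v
  proof (rule norm_le_of_quadratic_form_le)
    show "0 \<le> v \<bullet> B v" for v
      using upper[of v] t by (simp add: B inner_diff_right power2_norm_eq_inner field_simps)
    show "v \<bullet> B v \<le> q * (norm v)\<^sup>2" for v
      using lower[of v] t by (simp add: B q_def inner_diff_right power2_norm_eq_inner field_simps)
  qed (use q B_sym in \<open>auto intro: bounded_linear.linear blinfun.bounded_linear_right\<close>)
  then have norm_B: "norm B \<le> q"
    using q by (intro norm_blinfun_bound) auto
  \<comment> \<open>Symmetry is built into the closed set, so that the fixed point inherits
    it.\<close>
  define C where "C = {Y :: (real^'n) \<Rightarrow>\<^sub>L (real^'n). norm Y \<le> r \<and> (\<forall>v w. v \<bullet> blinfun_apply Y w = blinfun_apply Y v \<bullet> w)}"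
  define F where "F Y = (1 / 2) *\<^sub>R (B + (Y o\<^sub>L Y))" for Y
  have "C = cball 0 r \<inter> (\<Inter>v. \<Inter>w. {Y. v \<bullet> blinfun_apply Y w = blinfun_apply Y v \<bullet> w})"
    by (auto simp: C_def)
  moreover have "closed \<dots>"
    by (intro closed_Int closed_cball closed_INT ballI closed_Collect_eq continuous_intros)
  ultimately have closed_C: "closed C" by simp
  have "0 \<in> C" using r by (simp add: C_def)
  moreover have "F Y \<in> C" if Y: "Y \<in> C" for Y
  proof -
    have "norm (F Y) \<le> (1 / 2) * (norm B + norm Y * norm Y)"
      unfolding F_def by (simp, intro order_trans[OF norm_triangle_ineq] add_left_mono norm_blinfun_compose)
    also have "\<dots> \<le> (1 / 2) * (q + r * r)"
      using Y norm_B r by (intro mult_left_mono add_mono mult_mono) (auto simp: C_def)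
    finally have "norm (F Y) \<le> r" by (simp add: r2)
    moreover have "v \<bullet> F Y w = F Y v \<bullet> w" for v w
      using Y by (simp add: F_def C_def blinfun.bilinear_simps inner_add_left inner_add_right B_sym)
    ultimately show ?thesis by (simp add: C_def)
  qed
  moreover have "dist (F Y) (F Z) \<le> r * dist Y Z" if "Y \<in> C" "Z \<in> C" for Y Z
  proof -
    \<comment> \<open>\<open>Y\<close> and \<open>Z\<close> need not commute, so the difference of
      squares is split as \<open>Y (Y - Z) + (Y - Z) Z\<close>.\<close>
    have "F Y - F Z = (1 / 2) *\<^sub>R ((Y o\<^sub>L (Y - Z)) + ((Y - Z) o\<^sub>L Z))"
      by (rule blinfun_eqI) (simp add: F_def blinfun.bilinear_simps algebra_simps)
    then have "norm (F Y - F Z) \<le> (1 / 2) * (norm (Y o\<^sub>L (Y - Z)) + norm ((Y - Z) o\<^sub>L Z))"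
      by (simp add: norm_triangle_ineq)
    also have "\<dots> \<le> (1 / 2) * (norm Y * norm (Y - Z) + norm (Y - Z) * norm Z)"
      by (intro mult_left_mono add_mono norm_blinfun_compose) auto
    also have "\<dots> \<le> (1 / 2) * (r * norm (Y - Z) + norm (Y - Z) * r)"
      using that r by (intro mult_left_mono add_mono mult_mono) (auto simp: C_def)
    finally show ?thesis by (simp add: dist_norm)
  qed
  ultimately obtain Y where Y: "Y \<in> C" "F Y = Y"
    using Banach_fix[OF complete_eq_closed[THEN iffD2, OF closed_C], of r F] r by (auto simp: image_subset_iff)
  \<comment> \<open>The fixed-point equation in the form \<open>(1 - Y)\<^sup>2 = 1 - B\<close>,
    whose right side is \<open>H / t\<close>.\<close>
  have YY: "2 *\<^sub>R Y v - Y (Y v) = B v" for v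
  proof -
    have "2 *\<^sub>R F Y v = B v + Y (Y v)" by (simp add: F_def blinfun.bilinear_simps)
    then show ?thesis by (simp add: Y)
  qed
  define S where "S = matrix (\<lambda>v. sqrt t *\<^sub>R (v - Y v))"
  have S: "S *v v = sqrt t *\<^sub>R (v - Y v)" for v
    unfolding S_def by (subst matrix_vector_mul(3)) (auto intro!: bounded_linear_intros)
  have "psd S"
    unfolding psd_def symmetric_matrix_iff
  proof safe
    show "x \<bullet> (S *v y) = (S *v x) \<bullet> y" for x y
      using Y(1) by (simp add: S C_def inner_diff_left inner_diff_right)
    show "0 \<le> v \<bullet> (S *v v)" for v
    proof -
      have "v \<bullet> Y v \<le> norm v * norm (Y v)" by (rule norm_cauchy_schwarz)
      also have "\<dots> \<le> norm v * (norm Y * norm v)"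
        by (intro mult_left_mono norm_blinfun) auto
      also have "\<dots> \<le> norm v * (1 * norm v)"
        using Y(1) r by (intro mult_left_mono mult_right_mono) (auto simp: C_def)
      finally show ?thesis
        using t by (simp add: S inner_diff_right power2_norm_eq_inner[symmetric] power2_eq_square)
    qed
  qed
  moreover have "S ** S = H"
  proof (subst matrix_eq, rule allI)
    fix v
    have "(S ** S) *v v = t *\<^sub>R (v - (2 *\<^sub>R Y v - Y (Y v)))"
      using t by (simp add: matrix_vector_mul_assoc[symmetric] S blinfun.bilinear_simps algebra_simps scaleR_2)
    also have "\<dots> = H *v v"
      using t by (simp add: YY B)
    finally show "(S ** S) *v v = H *v v" .
  qed
  ultimately show ?thesis by blast
qed

lemma trace_conj_eq_sum:
  fixes D S :: "real ^ 'n ^ 'n"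
  assumes "transpose D = D"
  shows "trace (D ** (S ** D)) = (\<Sum>i\<in>UNIV. (D *v axis i 1) \<bullet> (S *v (D *v axis i 1)))"
proof -
  have "A $ i $ i = axis i 1 \<bullet> (A *v axis i 1)" for A :: "real ^ 'n ^ 'n" and i
    by (simp add: matrix_vector_mult_basis column_def inner_axis')
  then show ?thesis
    by (simp add: trace_def matrix_vector_mul_assoc[symmetric] symmetric_inner_mult[OF assms])
qed

text \<open>The difference \<open>D = S - T\<close> satisfies \<open>S D + D T = 0\<close>, so the nonnegative traces of \<open>D S D\<close> and
  \<open>D T D\<close> add up to 0.\<close>
lemma psd_sqrt_unique:
  fixes S T :: "real ^ 'n ^ 'n"
  assumes S: "psd S" and T: "psd T" and eq: "S ** S = T ** T" and inj: "\<And>v. S *v v = 0 \<Longrightarrow> v = 0"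
  shows "S = T"
proof -
  define D where "D = S - T"
  have D: "transpose D = D"
    using S T by (simp add: D_def psd_def transpose_def vec_eq_iff)
  have "S ** D + D ** T = 0"
    using eq by (simp add: D_def matrix_matrix_mult_def vec_eq_iff algebra_simps sum_subtractf)
  then have "trace (D ** (S ** D + D ** T)) = 0"
    by (simp add: trace_def)
  then have "trace (D ** (S ** D)) + trace (D ** (T ** D)) = 0"
    using trace_mul_sym[of D "D ** T"] by (simp add: matrix_add_ldistrib trace_add matrix_mul_assoc)
  then have "trace (D ** (S ** D)) = 0"
    using S T by (simp add: trace_conj_eq_sum[OF D] psd_def add_nonneg_eq_0_iff sum_nonneg)
  then have *: "(D *v axis i 1) \<bullet> (S *v (D *v axis i 1)) = 0" for i
    using S by (simp add: trace_conj_eq_sum[OF D] psd_def sum_nonneg_eq_0_iff)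
  \<comment> \<open>The form of \<open>S\<close> is nonnegative and vanishes at each column of
    \<open>D\<close>, which puts the columns in the kernel of \<open>S\<close>.\<close>
  have "S *v (D *v axis i 1) = 0" for i
    by (rule quadratic_form_eq_0_imp[where T="(*v) S", OF _ _ _ *])
       (use S in \<open>auto simp: psd_def symmetric_inner_mult\<close>)
  then have "D *v axis i 1 = 0" for i
    using inj by blast
  then have "D = 0"
    by (simp add: matrix_vector_mult_basis column_def vec_eq_iff)
  then show ?thesis by (simp add: D_def)
qed

text \<open>A definite description has its intended meaning only after existence and uniqueness; the
  lower bound by \<open>\<zeta>\<close> supplies the injectivity that uniqueness asks for.\<close>

lemma psd_sqrt_works:
  fixes H :: "real ^ 'n ^ 'n"
  assumes "transpose H = H" and \<zeta>: "0 < \<zeta>" and lower: "\<And>v. \<zeta> * (norm v)\<^sup>2 \<le> v \<bullet> (H *v v)"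
  shows "psd (psd_sqrt H)" "psd_sqrt H ** psd_sqrt H = H"
proof -
  obtain S where S: "psd S" "S ** S = H"
    using psd_sqrt_exists[OF assms] by blast
  have inj: "v = 0" if "S *v v = 0" for v
  proof -
    have "H *v v = 0" using that by (simp add: S(2)[symmetric] matrix_vector_mul_assoc[symmetric])
    with lower[of v] \<zeta> show ?thesis by (simp add: mult_le_0_iff)
  qed
  have "\<exists>!S. psd S \<and> S ** S = H"
  proof (rule ex1I[of _ S])
    show "T = S" if "psd T \<and> T ** T = H" for T
      using psd_sqrt_unique[of S T] S that inj by simp
  qed (simp add: S)
  from theI'[OF this] show "psd (psd_sqrt H)" "psd_sqrt H ** psd_sqrt H = H"
    by (auto simp: psd_sqrt_def)
qed

lemma inv_sqrt_works:
  fixes H :: "real ^ 'n ^ 'n"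
  assumes "transpose H = H" and \<zeta>: "0 < \<zeta>" and lower: "\<And>v. \<zeta> * (norm v)\<^sup>2 \<le> v \<bullet> (H *v v)"
  shows "psd_sqrt H ** inv_sqrt H = mat 1" "inv_sqrt H ** psd_sqrt H = mat 1"
    "transpose (inv_sqrt H) = inv_sqrt H"
proof -
  note S = psd_sqrt_works[OF assms]
  have "v = 0" if "psd_sqrt H *v v = 0" for v
  proof -
    have "H *v v = 0" by (subst S(2)[symmetric]) (simp add: that matrix_vector_mul_assoc[symmetric])
    with lower[of v] \<zeta> show ?thesis by (simp add: mult_le_0_iff)
  qed
  then have "invertible (psd_sqrt H)"
    unfolding invertible_left_inverse matrix_left_invertible_ker by blast
  then have "\<exists>W. psd_sqrt H ** W = mat 1 \<and> W ** psd_sqrt H = mat 1"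
    by (simp add: invertible_def)
  from someI_ex[OF this] show SW: "psd_sqrt H ** inv_sqrt H = mat 1" "inv_sqrt H ** psd_sqrt H = mat 1"
    by (auto simp: inv_sqrt_def matrix_inv_def)
  \<comment> \<open>Transposing the right-inverse equation makes the transpose a left inverse, and
    multiplying by \<open>inv_sqrt H\<close> on the right identifies the two.\<close>
  have "transpose (inv_sqrt H) ** psd_sqrt H = mat 1"
    using arg_cong[OF SW(1), of transpose] S(1) by (simp add: matrix_transpose_mul psd_def transpose_mat)
  then have "transpose (inv_sqrt H) ** psd_sqrt H ** inv_sqrt H = mat 1 ** inv_sqrt H"
    by simp
  then show "transpose (inv_sqrt H) = inv_sqrt H"
    unfolding matrix_mul_assoc[symmetric] SW(1) by simp
qed

subsection \<open>Taylor bounds\<close>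

text \<open>The Riesz vector of the derivative is assembled from its values on \<open>Basis\<close>;
  its uniqueness justifies the description in \<open>gradient\<close>.\<close>

lemma gradient_works:
  fixes f :: "'a::euclidean_space \<Rightarrow> real"
  assumes "f differentiable (at x)"
  shows "(f has_derivative (\<lambda>h. h \<bullet> gradient f x)) (at x)"
proof -
  obtain D where D: "(f has_derivative D) (at x)"
    using assms by (auto simp: differentiable_def)
  define g where "g = (\<Sum>b\<in>Basis. D b *\<^sub>R b)"
  have "D h = h \<bullet> g" for h
  proof -
    have "D h = D (\<Sum>b\<in>Basis. (h \<bullet> b) *\<^sub>R b)" by (simp add: euclidean_representation)
    also have "\<dots> = (\<Sum>b\<in>Basis. (h \<bullet> b) * D b)"
      using has_derivative_linear[OF D] by (simp add: linear_sum linear_scale)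
    finally show ?thesis by (simp add: g_def inner_sum_right mult.commute)
  qed
  then have "D = (\<lambda>h. h \<bullet> g)" by auto
  with D have g: "GDERIV f x :> g" by (simp add: gderiv_def)
  have "g' = g" if "GDERIV f x :> g'" for g'
    using has_derivative_unique[OF that[unfolded gderiv_def] g[unfolded gderiv_def]]
    by (metis vector_eq_ldot)
  with g have "\<exists>!g. GDERIV f x :> g" by blast
  from theI'[OF this] show ?thesis
    by (simp add: gradient_def gderiv_def)
qed

lemma DERIV_along_line:
  fixes f :: "'a::euclidean_space \<Rightarrow> real"
  assumes "f differentiable (at (x + t *\<^sub>R s))"
  shows "((\<lambda>t. f (x + t *\<^sub>R s)) has_real_derivative s \<bullet> gradient f (x + t *\<^sub>R s)) (at t)"
proof -
  have "((\<lambda>t. x + t *\<^sub>R s) has_derivative (\<lambda>h. h *\<^sub>R s)) (at t)"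
    by (auto intro!: derivative_eq_intros)
  from has_derivative_compose[OF this gradient_works[OF assms]] show ?thesis
    by (simp add: has_field_derivative_def mult_commute_abs)
qed

text \<open>Integration of a power bound without integrals: the primitive of the bound, plus or
  minus \<open>\<psi>\<close>, is nondecreasing. Applied repeatedly, it yields Taylor
  remainders.\<close>

lemma abs_diff_le_of_deriv_power_bound:
  fixes \<psi> :: "real \<Rightarrow> real"
  assumes d: "\<And>t. 0 \<le> t \<Longrightarrow> (\<psi> has_real_derivative \<psi>' t) (at t)"
    and b: "\<And>t. 0 \<le> t \<Longrightarrow> \<bar>\<psi>' t\<bar> \<le> K * t ^ n" and "0 \<le> t"
  shows "\<bar>\<psi> t - \<psi> 0\<bar> \<le> K * t ^ Suc n / real (Suc n)"
proof -
  have *: "((\<lambda>t. K * t ^ Suc n / real (Suc n)) has_real_derivative K * u ^ n) (at u)" for u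
    by (auto intro!: derivative_eq_intros simp del: power_Suc)
  have "K * 0 ^ Suc n / real (Suc n) - \<psi> 0 \<le> K * t ^ Suc n / real (Suc n) - \<psi> t"
  proof (rule DERIV_nonneg_imp_nondecreasing[OF \<open>0 \<le> t\<close>])
    fix u assume u: "0 \<le> u" "u \<le> t"
    have "((\<lambda>t. K * t ^ Suc n / real (Suc n) - \<psi> t) has_real_derivative K * u ^ n - \<psi>' u) (at u)"
      by (intro DERIV_diff * d u)
    then show "\<exists>y. ((\<lambda>t. K * t ^ Suc n / real (Suc n) - \<psi> t) has_real_derivative y) (at u) \<and> 0 \<le> y"
      using b[OF u(1)] by (auto simp: abs_le_iff)
  qed
  moreover have "K * 0 ^ Suc n / real (Suc n) + \<psi> 0 \<le> K * t ^ Suc n / real (Suc n) + \<psi> t"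
  proof (rule DERIV_nonneg_imp_nondecreasing[OF \<open>0 \<le> t\<close>])
    fix u assume u: "0 \<le> u" "u \<le> t"
    have "((\<lambda>t. K * t ^ Suc n / real (Suc n) + \<psi> t) has_real_derivative K * u ^ n + \<psi>' u) (at u)"
      by (intro DERIV_add * d u)
    then show "\<exists>y. ((\<lambda>t. K * t ^ Suc n / real (Suc n) + \<psi> t) has_real_derivative y) (at u) \<and> 0 \<le> y"
      using b[OF u(1)] by (intro exI[of _ "K * u ^ n + \<psi>' u"]) (auto simp: abs_le_iff)
  qed
  ultimately show ?thesis by (simp add: abs_le_iff)
qed

lemma L_smooth_Taylor:
  assumes "L_smooth L f"
  shows "\<bar>f (x + s) - f x - s \<bullet> gradient f x\<bar> \<le> L / 2 * (norm s)\<^sup>2"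
proof -
  have diff: "\<And>x. f differentiable (at x)" and lip: "\<And>x y. norm (gradient f x - gradient f y) \<le> L * norm (x - y)"
    using assms by (auto simp: L_smooth_def)
  define \<psi> where "\<psi> t = f (x + t *\<^sub>R s) - t * (s \<bullet> gradient f x)" for t
  have "\<bar>\<psi> 1 - \<psi> 0\<bar> \<le> (L * (norm s)\<^sup>2) * 1 ^ Suc 1 / real (Suc 1)"
  proof (rule abs_diff_le_of_deriv_power_bound)
    fix t :: real assume t: "0 \<le> t"
    show "(\<psi> has_real_derivative s \<bullet> (gradient f (x + t *\<^sub>R s) - gradient f x)) (at t)"
      unfolding \<psi>_def by (auto intro!: derivative_eq_intros DERIV_along_line diff simp: inner_diff_right)
    have "\<bar>s \<bullet> (gradient f (x + t *\<^sub>R s) - gradient f x)\<bar> \<le> norm s * norm (gradient f (x + t *\<^sub>R s) - gradient f x)"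
      by (rule Cauchy_Schwarz_ineq2)
    also have "\<dots> \<le> norm s * (L * norm (x + t *\<^sub>R s - x))"
      by (intro mult_left_mono lip) auto
    finally show "\<bar>s \<bullet> (gradient f (x + t *\<^sub>R s) - gradient f x)\<bar> \<le> L * (norm s)\<^sup>2 * t ^ 1"
      using t by (simp add: power2_eq_square mult_ac)
  qed simp
  then show ?thesis by (simp add: \<psi>_def algebra_simps)
qed

text \<open>Two integrations along the segment: the Hessian increment is linear in \<open>t\<close>,
  the gradient remainder \<open>\<theta>\<close> is quadratic with factor 1/2, and
  \<open>\<psi>\<close>, whose derivative is \<open>\<theta>\<close>, is cubic with factor
  1/6.\<close>

lemma lipschitz_hessian_Taylor:
  assumes "lipschitz_hessian \<gamma> f"
  shows "\<bar>f (x + s) - f x - s \<bullet> gradient f x - (s \<bullet> (hessian f x *v s)) / 2\<bar> \<le> \<gamma> / 6 * norm s ^ 3"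
proof -
  have diff: "\<And>x. f differentiable (at x)" and gdiff: "\<And>x. gradient f differentiable (at x)"
    and lip: "\<And>x y. onorm ((*v) (hessian f y - hessian f x)) \<le> \<gamma> * norm (y - x)"
    using assms by (auto simp: lipschitz_hessian_def)
  have hd: "(gradient f has_derivative (\<lambda>h. hessian f x *v h)) (at x)" for x
    using gdiff jacobian_works unfolding hessian_def by blast
  define \<theta> where "\<theta> t = s \<bullet> (gradient f (x + t *\<^sub>R s) - gradient f x) - t * (s \<bullet> (hessian f x *v s))" for t
  have \<theta>: "\<bar>\<theta> t\<bar> \<le> \<gamma> * norm s ^ 3 / 2 * t ^ 2" if "0 \<le> t" for t
  proof -
    have "\<bar>\<theta> t - \<theta> 0\<bar> \<le> (\<gamma> * norm s ^ 3) * t ^ Suc 1 / real (Suc 1)"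
    proof (rule abs_diff_le_of_deriv_power_bound[OF _ _ that])
      fix t :: real assume t: "0 \<le> t"
      have "((\<lambda>t. x + t *\<^sub>R s) has_derivative (\<lambda>h. h *\<^sub>R s)) (at t)"
        by (auto intro!: derivative_eq_intros)
      from has_derivative_compose[OF this hd]
      have "((\<lambda>t. gradient f (x + t *\<^sub>R s)) has_derivative (\<lambda>h. h *\<^sub>R (hessian f (x + t *\<^sub>R s) *v s))) (at t)"
        by (simp add: matrix_vector_mult_scaleR)
      then have "(\<theta> has_derivative (\<lambda>h. h * (s \<bullet> ((hessian f (x + t *\<^sub>R s) - hessian f x) *v s)))) (at t)"
        unfolding \<theta>_def
        by (auto intro!: derivative_eq_intros simp: fun_eq_iff inner_diff_right matrix_vector_mult_diff_rdistrib right_diff_distrib)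
      then show "(\<theta> has_real_derivative s \<bullet> ((hessian f (x + t *\<^sub>R s) - hessian f x) *v s)) (at t)"
        by (simp add: has_field_derivative_def mult_commute_abs)
      have "\<bar>s \<bullet> ((hessian f (x + t *\<^sub>R s) - hessian f x) *v s)\<bar>
          \<le> norm s * norm ((hessian f (x + t *\<^sub>R s) - hessian f x) *v s)"
        by (rule Cauchy_Schwarz_ineq2)
      also have "\<dots> \<le> norm s * (onorm ((*v) (hessian f (x + t *\<^sub>R s) - hessian f x)) * norm s)"
        by (intro mult_left_mono onorm) auto
      also have "\<dots> \<le> norm s * ((\<gamma> * norm (x + t *\<^sub>R s - x)) * norm s)"
        by (intro mult_left_mono mult_right_mono lip) auto
      finally show "\<bar>s \<bullet> ((hessian f (x + t *\<^sub>R s) - hessian f x) *v s)\<bar> \<le> \<gamma> * norm s ^ 3 * t ^ 1"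
        using t by (simp add: power3_eq_cube mult_ac)
    qed
    then show ?thesis by (simp add: \<theta>_def power2_eq_square)
  qed
  define \<psi> where "\<psi> t = f (x + t *\<^sub>R s) - t * (s \<bullet> gradient f x) - t\<^sup>2 / 2 * (s \<bullet> (hessian f x *v s))" for t
  have "\<bar>\<psi> 1 - \<psi> 0\<bar> \<le> (\<gamma> * norm s ^ 3 / 2) * 1 ^ Suc 2 / real (Suc 2)"
  proof (rule abs_diff_le_of_deriv_power_bound)
    fix t :: real assume t: "0 \<le> t"
    show "(\<psi> has_real_derivative \<theta> t) (at t)"
      unfolding \<psi>_def \<theta>_def by (auto intro!: derivative_eq_intros DERIV_along_line diff simp: inner_diff_right)
  qed (use \<theta> in auto)
  then show ?thesis by (simp add: \<psi>_def algebra_simps)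
qed

section \<open>Bounds on the Hessian form, obtained as limits of difference quotients\<close>

lemma le_of_le_add_small:
  fixes a b C :: real
  assumes "\<And>t. 0 < t \<Longrightarrow> a \<le> b + C * t"
  shows "a \<le> b"
proof (rule field_le_epsilon)
  fix e :: real assume "0 < e"
  have "C * (e / (\<bar>C\<bar> + 1)) \<le> (\<bar>C\<bar> + 1) * (e / (\<bar>C\<bar> + 1))"
    using \<open>0 < e\<close> by (intro mult_right_mono) auto
  also have "\<dots> = e" by simp
  finally show "a \<le> b + e"
    using assms[of "e / (\<bar>C\<bar> + 1)"] \<open>0 < e\<close> by simp
qed

text \<open>The two Taylor bounds are compared at \<open>t *\<^sub>R s\<close>; after division by
  \<open>t\<^sup>2\<close> the cubic error is of order \<open>t\<close> and vanishes.\<close>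

lemma hessian_le_of_L_smooth:
  assumes "lipschitz_hessian \<gamma> f" "L_smooth L f"
  shows "s \<bullet> (hessian f x *v s) \<le> L * (norm s)\<^sup>2"
proof (rule le_of_le_add_small)
  fix t :: real assume t: "0 < t"
  have scale: "(norm (t *\<^sub>R s))\<^sup>2 = t\<^sup>2 * (norm s)\<^sup>2" "norm (t *\<^sub>R s) ^ 3 = t * t\<^sup>2 * norm s ^ 3"
    "(t *\<^sub>R s) \<bullet> (hessian f x *v (t *\<^sub>R s)) = t\<^sup>2 * (s \<bullet> (hessian f x *v s))"
    using t by (simp_all add: matrix_vector_mult_scaleR power_mult_distrib power2_eq_square power3_eq_cube)
  have "t\<^sup>2 * (s \<bullet> (hessian f x *v s)) / 2 \<le> L / 2 * (t\<^sup>2 * (norm s)\<^sup>2) + \<gamma> / 6 * (t * t\<^sup>2 * norm s ^ 3)"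
    using abs_le_D1[OF L_smooth_Taylor[OF assms(2), of x "t *\<^sub>R s"]]
      abs_le_D2[OF lipschitz_hessian_Taylor[OF assms(1), of x "t *\<^sub>R s"]]
    unfolding scale by argo
  also have "\<dots> = t\<^sup>2 * (L * (norm s)\<^sup>2 + (\<gamma> / 3 * norm s ^ 3) * t) / 2"
    by (simp add: algebra_simps)
  finally show "s \<bullet> (hessian f x *v s) \<le> L * (norm s)\<^sup>2 + (\<gamma> / 3 * norm s ^ 3) * t"
    using t by simp
qed

lemma hessian_ge_of_strongly_convex:
  assumes "lipschitz_hessian \<gamma> f" "strongly_convex \<tau> f"
  shows "\<tau> * (norm s)\<^sup>2 \<le> s \<bullet> (hessian f x *v s)"
proof (rule le_of_le_add_small)
  fix t :: real assume t: "0 < t"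
  have "f (x + t *\<^sub>R s) \<ge> f x + gradient f x \<bullet> (x + t *\<^sub>R s - x) + \<tau> / 2 * (norm (x + t *\<^sub>R s - x))\<^sup>2"
    using assms(2) unfolding strongly_convex_def by blast
  then have sc: "f x + (t *\<^sub>R s) \<bullet> gradient f x + \<tau> / 2 * (norm (t *\<^sub>R s))\<^sup>2 \<le> f (x + t *\<^sub>R s)"
    by (simp add: inner_commute)
  have scale: "(norm (t *\<^sub>R s))\<^sup>2 = t\<^sup>2 * (norm s)\<^sup>2" "norm (t *\<^sub>R s) ^ 3 = t * t\<^sup>2 * norm s ^ 3"
    "(t *\<^sub>R s) \<bullet> (hessian f x *v (t *\<^sub>R s)) = t\<^sup>2 * (s \<bullet> (hessian f x *v s))"
    using t by (simp_all add: matrix_vector_mult_scaleR power_mult_distrib power2_eq_square power3_eq_cube)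
  have "\<tau> / 2 * (t\<^sup>2 * (norm s)\<^sup>2) \<le> t\<^sup>2 * (s \<bullet> (hessian f x *v s)) / 2 + \<gamma> / 6 * (t * t\<^sup>2 * norm s ^ 3)"
    using sc abs_le_D1[OF lipschitz_hessian_Taylor[OF assms(1), of x "t *\<^sub>R s"]]
    unfolding scale by argo
  then have "t\<^sup>2 * (\<tau> * (norm s)\<^sup>2) / 2 \<le> t\<^sup>2 * (s \<bullet> (hessian f x *v s) + (\<gamma> / 3 * norm s ^ 3) * t) / 2"
    by (simp add: algebra_simps)
  then show "\<tau> * (norm s)\<^sup>2 \<le> s \<bullet> (hessian f x *v s) + (\<gamma> / 3 * norm s ^ 3) * t"
    using t by simp
qed

text \<open>Near the minimizer the Hessian varies by at most a fraction of \<open>\<tau>\<close>, so \<open>f\<close> is bounded below by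
  a quadratic in the metric \<open>H\<close>, whose minimum is read off from the dual norm of the gradient.\<close>
lemma suboptimality_le:
  fixes f :: "real ^ 'n \<Rightarrow> real" and S W H :: "real ^ 'n ^ 'n"
  assumes hess: "lipschitz_hessian \<gamma> f" and convex: "strongly_convex \<tau> f"
    and SW: "S ** W = mat 1" and S: "\<And>v. (norm (S *v v))\<^sup>2 = v \<bullet> (H *v v)" and W: "\<And>x y. x \<bullet> (W *v y) = (W *v x) \<bullet> y"
    and WS: "W ** S = mat 1"
    and lower: "\<And>v. \<rho> * (v \<bullet> (H *v v)) \<le> v \<bullet> (hessian f x *v v)" and \<rho>: "0 < \<rho>"
    and close: "\<gamma> * norm (x - y) \<le> 3 * \<tau> / 64"
  shows "f x - f y \<le> 32 / 63 / \<rho> * (norm (W *v gradient f x))\<^sup>2"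
proof -
  define v where "v = y - x"
  define g w where "g = W *v gradient f x" and "w = S *v v"
  have "\<gamma> / 6 * norm v ^ 3 = (\<gamma> * norm (x - y)) * (norm v)\<^sup>2 / 6"
    by (simp add: v_def norm_minus_commute power2_eq_square power3_eq_cube)
  \<comment> \<open>This explains 3/64: a sixth of it is 1/128, so the cubic error takes 1/128 of
    the Hessian form and leaves 1/2 - 1/128 = 63/128.\<close>
  also have "\<dots> \<le> (3 * \<tau> / 64) * (norm v)\<^sup>2 / 6"
    by (intro divide_right_mono mult_right_mono close) auto
  also have "\<dots> \<le> (v \<bullet> (hessian f x *v v)) / 128"
    using hessian_ge_of_strongly_convex[OF hess convex, of v x] by simp
  finally have "\<gamma> / 6 * norm v ^ 3 \<le> (v \<bullet> (hessian f x *v v)) / 128" .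
  moreover have "f x + v \<bullet> gradient f x + (v \<bullet> (hessian f x *v v)) / 2 - \<gamma> / 6 * norm v ^ 3 \<le> f y"
    using abs_le_D2[OF lipschitz_hessian_Taylor[OF hess, of x v]] by (simp add: v_def)
  ultimately have "f x + v \<bullet> gradient f x + 63 / 128 * (v \<bullet> (hessian f x *v v)) \<le> f y"
    by simp
  moreover have "v \<bullet> gradient f x = g \<bullet> w"
  proof -
    have "g \<bullet> w = gradient f x \<bullet> (W *v (S *v v))" by (simp add: g_def w_def W)
    then show ?thesis by (simp add: matrix_vector_mul_assoc WS inner_commute)
  qed
  moreover have "\<rho> * (norm w)\<^sup>2 \<le> v \<bullet> (hessian f x *v v)"
    using lower[of v] by (simp add: w_def S)
  ultimately have "f x - f y \<le> - (g \<bullet> w) - 63 / 128 * \<rho> * (norm w)\<^sup>2" by simp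
  also have "\<dots> \<le> 32 / 63 / \<rho> * (norm g)\<^sup>2"
  proof -
    \<comment> \<open>Completing the square at the minimizer
      \<open>w = - (64 / 63 / \<rho>) *\<^sub>R g\<close> of the quadratic lower bound.\<close>
    have "0 \<le> (norm ((64 / 63 / \<rho>) *\<^sub>R g + w))\<^sup>2" by simp
    also have "\<dots> = (64 / 63 / \<rho>)\<^sup>2 * (norm g)\<^sup>2 + 2 * (64 / 63 / \<rho>) * (g \<bullet> w) + (norm w)\<^sup>2"
      by (simp only: power2_norm_eq_inner)
        (simp add: inner_add_left inner_add_right inner_commute[of w g] power2_eq_square algebra_simps)
    finally have "0 \<le> (63 / 128 * \<rho>) * ((64 / 63 / \<rho>)\<^sup>2 * (norm g)\<^sup>2 + 2 * (64 / 63 / \<rho>) * (g \<bullet> w) + (norm w)\<^sup>2)"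
      using \<rho> by simp
    also have "\<dots> = 32 / 63 / \<rho> * (norm g)\<^sup>2 + g \<bullet> w + 63 / 128 * \<rho> * (norm w)\<^sup>2"
      using \<rho> by (simp add: field_simps power2_eq_square)
    finally show ?thesis by simp
  qed
  finally show ?thesis by (simp add: g_def)
qed

subsection \<open>One step of the algorithm\<close>

text \<open>A step \<open>t\<close> against the gradient lowers \<open>f\<close> to first order in
  \<open>t\<close>, while smoothness limits the error to second order.\<close>

lemma gradient_eq_0_at_minimum:
  assumes "L_smooth L f" and min: "\<And>y. f x \<le> f y"
  shows "gradient f x = 0"
proof -
  let ?g = "gradient f x"
  have "(norm ?g)\<^sup>2 \<le> 0"
  proof (rule le_of_le_add_small)
    fix t :: real assume t: "0 < t"
    have scale: "(- t *\<^sub>R ?g) \<bullet> ?g = - t * (norm ?g)\<^sup>2" "(norm (- t *\<^sub>R ?g))\<^sup>2 = t * t * (norm ?g)\<^sup>2"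
      by (simp add: power2_norm_eq_inner, simp add: power_mult_distrib power2_eq_square)
    have "f (x + - t *\<^sub>R ?g) - f x - (- t *\<^sub>R ?g) \<bullet> ?g \<le> L / 2 * (norm (- t *\<^sub>R ?g))\<^sup>2"
      by (rule abs_le_D1[OF L_smooth_Taylor[OF assms(1)]])
    then have "t * (norm ?g)\<^sup>2 \<le> L / 2 * (t * t * (norm ?g)\<^sup>2)"
      using min[of "x + - t *\<^sub>R ?g"] unfolding scale by argo
    then have "t * (norm ?g)\<^sup>2 \<le> t * ((L / 2 * (norm ?g)\<^sup>2) * t)" by (simp add: mult_ac)
    then show "(norm ?g)\<^sup>2 \<le> 0 + (L / 2 * (norm ?g)\<^sup>2) * t" using t by simp
  qed
  then show ?thesis by simp
qed

text \<open>The step \<open>- \<eta> W v\<close> has length \<open>\<eta> * norm v\<close> in the metric \<open>H = S\<^sup>2\<close>, which dominates half the Hessian.\<close>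
lemma preconditioned_step_le:
  fixes f :: "real ^ 'n \<Rightarrow> real" and S W H :: "real ^ 'n ^ 'n"
  assumes hess: "lipschitz_hessian \<gamma> f" and \<gamma>: "0 \<le> \<gamma>" and \<eta>: "0 \<le> \<eta>" and z: "0 < z"
    and upper: "\<And>v. v \<bullet> (hessian f x *v v) \<le> 2 * (v \<bullet> (H *v v))"
    and S: "\<And>v. (norm (S *v v))\<^sup>2 = v \<bullet> (H *v v)" and SW: "S ** W = mat 1"
    and W: "\<And>x y. x \<bullet> (W *v y) = (W *v x) \<bullet> y" and W_le: "\<And>v. norm (W *v v) \<le> norm v / z"
  shows "f (x - \<eta> *\<^sub>R (W *v v)) \<le> f x - \<eta> * (v \<bullet> (W *v gradient f x)) + \<eta>\<^sup>2 * (norm v)\<^sup>2 + \<gamma> / 6 * ((\<eta> / z) ^ 3 * norm v ^ 3)"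
proof -
  define s where "s = - (\<eta> *\<^sub>R (W *v v))"
  have "S *v (W *v v) = v" by (simp add: matrix_vector_mul_assoc SW)
  then have "(norm (S *v s))\<^sup>2 = \<eta>\<^sup>2 * (norm v)\<^sup>2"
    by (simp add: s_def matrix_vector_mult_scaleR power_mult_distrib flip: scaleR_minus_left)
  with upper[of s] have "(s \<bullet> (hessian f x *v s)) / 2 \<le> \<eta>\<^sup>2 * (norm v)\<^sup>2" by (simp add: S)
  moreover have "norm s ^ 3 \<le> (\<eta> / z) ^ 3 * norm v ^ 3"
  proof -
    have "norm s \<le> \<eta> * (norm v / z)" using mult_left_mono[OF W_le[of v] \<eta>] \<eta> by (simp add: s_def)
    then have "norm s ^ 3 \<le> (\<eta> * (norm v / z)) ^ 3" by (intro power_mono) auto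
    then show ?thesis by (simp add: power_mult_distrib power_divide)
  qed
  then have "\<gamma> / 6 * norm s ^ 3 \<le> \<gamma> / 6 * ((\<eta> / z) ^ 3 * norm v ^ 3)"
    using \<gamma> by (intro mult_left_mono) auto
  moreover have "s \<bullet> gradient f x = - \<eta> * (v \<bullet> (W *v gradient f x))"
    by (simp add: s_def W)
  moreover have "f (x + s) - f x - s \<bullet> gradient f x - (s \<bullet> (hessian f x *v s)) / 2 \<le> \<gamma> / 6 * norm s ^ 3"
    by (rule abs_le_D1[OF lipschitz_hessian_Taylor[OF hess]])
  ultimately have "f (x + s) \<le> f x - \<eta> * (v \<bullet> (W *v gradient f x)) + \<eta>\<^sup>2 * (norm v)\<^sup>2 + \<gamma> / 6 * ((\<eta> / z) ^ 3 * norm v ^ 3)"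
    by linarith
  then show ?thesis by (simp add: s_def)
qed

text \<open>Writing \<open>\<zeta>\<close> as the square of \<open>z\<close> replaces the
  half-integer power by an integer one.\<close>

lemma zo_error_eq:
  assumes "0 < z"
  shows "zo_error d b L \<gamma> (z\<^sup>2) \<mu> = real b * (\<mu>\<^sup>2 * L\<^sup>2 / (64 * z ^ 4) * (real d + 5)\<^sup>2
      + \<mu>\<^sup>2 * L\<^sup>2 / (128 * z\<^sup>2) * (real d + 38)
      + \<gamma> * (real b)\<^sup>2 * \<mu> ^ 3 * L ^ 3 / (6144 * z ^ 9) * ((real d + 110) * sqrt (real d + 110)))"
proof -
  have "z\<^sup>2 powr (9 / 2) = z powr 9"
    using assms by (simp add: powr_powr flip: powr_numeral)
  then have "z\<^sup>2 powr (9 / 2) = z ^ 9" using assms by simp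
  moreover have "(real d + 110) powr (3 / 2) = (real d + 110) powr (1 + 1 / 2)" by simp
  then have "(real d + 110) powr (3 / 2) = (real d + 110) * sqrt (real d + 110)"
    by (simp only: powr_add powr_half_sqrt) simp
  ultimately show ?thesis by (simp add: zo_error_def)
qed

text \<open>The numerical core. Terms in \<open>n\<close> are weighed against the gain 7/8, and
  terms in \<open>c\<close> are matched with \<open>zo_error\<close>; \<open>E1\<close>,
  \<open>E2\<close>, \<open>E3\<close> stand for the three expectations.\<close>

lemma descent_bound:
  fixes D B n z c \<eta> \<gamma> :: real
  assumes D: "1 \<le> D" and B: "1 \<le> B" "B \<le> D + 2" and \<eta>: "\<eta> = B / (16 * (D + 2))"
    and n: "0 \<le> n" and z: "0 < z" and c: "c = \<mu> * L / (2 * z\<^sup>2)" and pos: "0 < \<gamma>" "0 < L" "0 < \<mu>"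
    and close: "\<gamma> * n \<le> z ^ 3 * (D * sqrt D) / (33 * (D + 2) * B\<^sup>2)"
    and E1: "7 / 8 * n\<^sup>2 - 2 * c\<^sup>2 * (D * (D + 2)) \<le> E1"
    and E2: "E2 \<le> (4 * (D + 2) * n\<^sup>2 + 2 * c\<^sup>2 * (D * (D + 2) * (D + 4))) / B + (2 * n\<^sup>2 + 2 * c\<^sup>2 * (D * (D + 2)))"
    and E3: "E3 \<le> 4 * (8 * (D + 2) ^ 3 * n ^ 3 / (D * sqrt D)
        + c ^ 3 * (D * (D + 2) * (D + 4) * (D + 6) * sqrt (D + 110)))"
  shows "- \<eta> * E1 + \<eta>\<^sup>2 * E2 + \<gamma> / 6 * ((\<eta> / z) ^ 3 * E3)
    \<le> - (8 / 63 * \<eta> * n\<^sup>2) + B * (\<mu>\<^sup>2 * L\<^sup>2 / (64 * z ^ 4) * (D + 5)\<^sup>2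
      + \<mu>\<^sup>2 * L\<^sup>2 / (128 * z\<^sup>2) * (D + 38)
      + \<gamma> * B\<^sup>2 * \<mu> ^ 3 * L ^ 3 / (6144 * z ^ 9) * ((D + 110) * sqrt (D + 110)))"
proof -
  have \<eta>0: "0 < \<eta>" and \<eta>16: "\<eta> \<le> 1 / 16" using D B by (auto simp: \<eta> field_simps)
  have \<eta>B: "\<eta> / B = 1 / (16 * (D + 2))" using B by (simp add: \<eta>)
  have t1: "- \<eta> * E1 \<le> \<eta> * (- 7 / 8 * n\<^sup>2 + 2 * c\<^sup>2 * (D * (D + 2)))"
    using mult_left_mono[OF E1, of \<eta>] \<eta>0 by (simp add: algebra_simps)
  have t2: "\<eta>\<^sup>2 * E2 \<le> \<eta> * (3 / 8 * n\<^sup>2 + c\<^sup>2 * (D * (D + 4) / 8 + D * (D + 2) / 8))"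
  proof -
    have "\<eta> * E2 \<le> \<eta> * ((4 * (D + 2) * n\<^sup>2 + 2 * c\<^sup>2 * (D * (D + 2) * (D + 4))) / B + (2 * n\<^sup>2 + 2 * c\<^sup>2 * (D * (D + 2))))"
      using E2 \<eta>0 by (intro mult_left_mono) auto
    also have "\<dots> = (\<eta> / B) * (4 * (D + 2) * n\<^sup>2 + 2 * c\<^sup>2 * (D * (D + 2) * (D + 4))) + \<eta> * (2 * n\<^sup>2 + 2 * c\<^sup>2 * (D * (D + 2)))"
    proof -
      have "\<eta> * (x / B + y) = (\<eta> / B) * x + \<eta> * y" for x y by (simp add: distrib_left)
      then show ?thesis .
    qed
    also have "(\<eta> / B) * (4 * (D + 2) * n\<^sup>2 + 2 * c\<^sup>2 * (D * (D + 2) * (D + 4))) = n\<^sup>2 / 4 + c\<^sup>2 * (D * (D + 4)) / 8"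
      unfolding \<eta>B using D by (simp add: divide_simps) (simp add: algebra_simps)
    also have "\<eta> * (2 * n\<^sup>2 + 2 * c\<^sup>2 * (D * (D + 2))) \<le> 1 / 16 * (2 * n\<^sup>2 + 2 * c\<^sup>2 * (D * (D + 2)))"
      using \<eta>16 D by (intro mult_right_mono) auto
    finally have "\<eta> * E2 \<le> 3 / 8 * n\<^sup>2 + c\<^sup>2 * (D * (D + 4) / 8 + D * (D + 2) / 8)" by (simp add: field_simps)
    from mult_left_mono[OF this, of \<eta>] \<eta>0 show ?thesis by (simp add: power2_eq_square mult.assoc)
  qed
  have sD: "0 < D * sqrt D" using D by simp
  define k where "k = \<gamma> / 6 * (\<eta> / z) ^ 3"
  have k: "0 \<le> k" using pos \<eta>0 z by (simp add: k_def)
  \<comment> \<open>One factor \<open>n\<close> is traded for the closeness bound. Since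
    \<open>\<eta> * (D + 2) / B\<close> is 1/16, all dimensions cancel, and 16/3 divided by 256 * 33
    is 1/1584.\<close>
  have t3a: "k * (4 * (8 * (D + 2) ^ 3 * n ^ 3 / (D * sqrt D))) \<le> \<eta> * (n\<^sup>2 / 100)"
  proof -
    have "k * (4 * (8 * (D + 2) ^ 3 * n ^ 3 / (D * sqrt D)))
        = (16 / 3) * \<eta> * n\<^sup>2 * ((\<eta> * (D + 2))\<^sup>2 * (D + 2) / (z ^ 3 * (D * sqrt D))) * (\<gamma> * n)"
    proof -
      have "\<gamma> / 6 * (\<eta> / z) ^ 3 * (4 * (8 * Q ^ 3 * n ^ 3 / s))
          = (16 / 3) * \<eta> * n\<^sup>2 * ((\<eta> * Q)\<^sup>2 * Q / (z ^ 3 * s)) * (\<gamma> * n)" if "0 < s" for s Q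
        using that z by (simp add: power2_eq_square power3_eq_cube field_simps)
      then show ?thesis unfolding k_def using sD by blast
    qed
    also have "\<dots> \<le> (16 / 3) * \<eta> * n\<^sup>2 * ((\<eta> * (D + 2))\<^sup>2 * (D + 2) / (z ^ 3 * (D * sqrt D)))
        * (z ^ 3 * (D * sqrt D) / (33 * (D + 2) * B\<^sup>2))"
      using \<eta>0 D z by (intro mult_left_mono close) auto
    also have "\<dots> = (16 / 3) * \<eta> * n\<^sup>2 * ((\<eta> * (D + 2) / B)\<^sup>2 / 33)"
    proof -
      have *: "((\<eta> * Q)\<^sup>2 * Q / (z ^ 3 * s)) * (z ^ 3 * s / (33 * Q * B\<^sup>2)) = (\<eta> * Q / B)\<^sup>2 / 33"
        if "0 < s" "0 < Q" for s Q
        using that z B by (simp add: power_divide)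
      have "0 < D + 2" using D by simp
      from *[OF sD this] show ?thesis by (simp only: mult.assoc[of "16 / 3 * \<eta> * n\<^sup>2"])
    qed
    also have "\<eta> * (D + 2) / B = 1 / 16" using D B by (simp add: \<eta>)
    also have "16 / 3 * \<eta> * n\<^sup>2 * ((1 / 16)\<^sup>2 / 33) = \<eta> * n\<^sup>2 * (1 / 1584)"
      by (simp add: power2_eq_square)
    also have "\<dots> \<le> \<eta> * n\<^sup>2 * (1 / 100)" using \<eta>0 by (intro mult_left_mono) auto
    finally show ?thesis by simp
  qed
  have t3b: "k * (4 * (c ^ 3 * (D * (D + 2) * (D + 4) * (D + 6) * sqrt (D + 110))))
      \<le> B * (\<gamma> * B\<^sup>2 * \<mu> ^ 3 * L ^ 3 / (6144 * z ^ 9) * ((D + 110) * sqrt (D + 110)))"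
  proof -
    define q where "q = sqrt (D + 110)"
    have q: "0 \<le> q" using D by (simp add: q_def)
    define C where "C = \<gamma> * B ^ 3 * \<mu> ^ 3 * L ^ 3 / (6144 * z ^ 9)"
    have C: "0 \<le> C" using pos B z by (simp add: C_def)
    \<comment> \<open>Here 6144 appears: \<open>k\<close> brings 6 * 16^3 = 24576 and
      \<open>c ^ 3\<close> brings 8, so with the factor 4 the denominator is 8 * 6144. The spare 8
      joins \<open>(D + 2)\<^sup>2\<close>.\<close>
    have "k * (4 * (c ^ 3 * (D * (D + 2) * (D + 4) * (D + 6) * q)))
        = C * ((D * (D + 4)) * (D + 6) * q / (8 * (D + 2)\<^sup>2))"
    proof -
      have z9: "z ^ 9 = z ^ 3 * (z\<^sup>2) ^ 3" by (simp flip: power_mult power_add)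
      have c3: "c ^ 3 = \<mu> ^ 3 * L ^ 3 / (8 * (z\<^sup>2) ^ 3)"
        by (simp add: c power_divide power_mult_distrib)
      have k': "k = \<gamma> * B ^ 3 / (24576 * (D + 2) ^ 3 * z ^ 3)"
      proof -
        have "\<gamma> / 6 * (B / (16 * Q) / z) ^ 3 = \<gamma> * B ^ 3 / (24576 * Q ^ 3 * z ^ 3)" for Q
          by (simp add: power_divide power_mult_distrib)
        then show ?thesis unfolding k_def \<eta> .
      qed
      have P: "(D + 2) ^ 3 = (D + 2) * (D + 2)\<^sup>2" by (simp add: power2_eq_square power3_eq_cube)
      show ?thesis
        unfolding k' c3 C_def z9 P using D z by (simp add: divide_simps)
    qed
    also have "\<dots> \<le> C * ((D + 110) * q)"
    proof (rule mult_left_mono[OF _ C])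
      have "(D * (D + 4)) * (D + 6) * q \<le> (8 * (D + 2)\<^sup>2) * (D + 110) * q"
      proof (rule mult_right_mono[OF mult_mono q])
        have "0 \<le> D * D" by simp
        then show "D * (D + 4) \<le> 8 * (D + 2)\<^sup>2" using D by (simp add: power2_eq_square algebra_simps)
      qed (use D in auto)
      then show "(D * (D + 4)) * (D + 6) * q / (8 * (D + 2)\<^sup>2) \<le> (D + 110) * q"
        using D by (subst pos_divide_le_eq) (auto simp: mult_ac)
    qed
    finally show ?thesis by (simp add: C_def q_def power2_eq_square power3_eq_cube mult_ac)
  qed
  have t3: "\<gamma> / 6 * ((\<eta> / z) ^ 3 * E3) \<le> \<eta> * (n\<^sup>2 / 100)
      + B * (\<gamma> * B\<^sup>2 * \<mu> ^ 3 * L ^ 3 / (6144 * z ^ 9) * ((D + 110) * sqrt (D + 110)))"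
  proof -
    have "\<gamma> / 6 * ((\<eta> / z) ^ 3 * E3) = k * E3" by (simp add: k_def)
    also have "\<dots> \<le> k * (4 * (8 * (D + 2) ^ 3 * n ^ 3 / (D * sqrt D)
        + c ^ 3 * (D * (D + 2) * (D + 4) * (D + 6) * sqrt (D + 110))))"
      by (rule mult_left_mono[OF E3 k])
    also have "\<dots> = k * (4 * (8 * (D + 2) ^ 3 * n ^ 3 / (D * sqrt D)))
        + k * (4 * (c ^ 3 * (D * (D + 2) * (D + 4) * (D + 6) * sqrt (D + 110))))"
      by (simp only: distrib_left)
    finally show ?thesis using t3a t3b by linarith
  qed
  \<comment> \<open>The first summand of \<open>zo_error\<close> is exactly
    \<open>\<eta> * c\<^sup>2 * (D + 2) * (D + 5)\<^sup>2\<close>, which reduces the claim to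
    polynomials in \<open>D\<close>.\<close>
  have t4: "\<eta> * (c\<^sup>2 * (2 * (D * (D + 2)) + D * (D + 4) / 8 + D * (D + 2) / 8)) \<le> B * (\<mu>\<^sup>2 * L\<^sup>2 / (64 * z ^ 4) * (D + 5)\<^sup>2)"
  proof -
    have "\<eta> * (c\<^sup>2 * (2 * (D * (D + 2)) + D * (D + 4) / 8 + D * (D + 2) / 8)) \<le> \<eta> * (c\<^sup>2 * ((D + 2) * (D + 5)\<^sup>2))"
    proof (intro mult_left_mono)
      have "(D + 2) * (D + 5)\<^sup>2 - (2 * (D * (D + 2)) + D * (D + 4) / 8 + D * (D + 2) / 8)
          = D ^ 3 + 39 / 4 * D\<^sup>2 + 161 / 4 * D + 50"
        by (simp add: power2_eq_square power3_eq_cube field_simps)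
      also have "\<dots> \<ge> 0" using D by simp
      finally show "2 * (D * (D + 2)) + D * (D + 4) / 8 + D * (D + 2) / 8 \<le> (D + 2) * (D + 5)\<^sup>2"
        by simp
    qed (use \<eta>0 in auto)
    also have "\<dots> = B * (\<mu>\<^sup>2 * L\<^sup>2 / (64 * z ^ 4) * (D + 5)\<^sup>2)"
    proof -
      have "B / (16 * Q) * ((\<mu> * L / (2 * z\<^sup>2))\<^sup>2 * (Q * P)) = B * (\<mu>\<^sup>2 * L\<^sup>2 / (64 * z ^ 4) * P)"
        if "0 < Q" for P Q
        using that by (simp add: power_divide power_mult_distrib flip: power_mult)
      from this[of "D + 2"] D show ?thesis unfolding \<eta> c by simp
    qed
    finally show ?thesis .
  qed
  have t5: "0 \<le> B * (\<mu>\<^sup>2 * L\<^sup>2 / (128 * z\<^sup>2) * (D + 38))" using B D by simp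
  have "\<eta> * (- 7 / 8 * n\<^sup>2 + 2 * c\<^sup>2 * (D * (D + 2))) + \<eta> * (3 / 8 * n\<^sup>2 + c\<^sup>2 * (D * (D + 4) / 8 + D * (D + 2) / 8)) + \<eta> * (n\<^sup>2 / 100)
      = \<eta> * (c\<^sup>2 * (2 * (D * (D + 2)) + D * (D + 4) / 8 + D * (D + 2) / 8)) - 49 / 100 * (\<eta> * n\<^sup>2)"
    by (simp add: field_simps)
  moreover have "8 / 63 * (\<eta> * n\<^sup>2) \<le> 49 / 100 * (\<eta> * n\<^sup>2)" using \<eta>0 by (intro mult_right_mono) auto
  moreover have "8 / 63 * \<eta> * n\<^sup>2 = 8 / 63 * (\<eta> * n\<^sup>2)" by simp
  ultimately show ?thesis using t1 t2 t3 t4 t5 unfolding distrib_left[of B] by linarith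
qed

lemma loewner_le_imp:
  fixes A B :: "real ^ 'n ^ 'n"
  assumes "B \<preceq>\<^sub>L A"
  shows "v \<bullet> (B *v v) \<le> v \<bullet> (A *v v)"
  using assms by (simp add: loewner_le_def psd_def matrix_vector_mult_diff_rdistrib inner_diff_right)

lemma scaleR_matrix_form:
  fixes A :: "real ^ 'n ^ 'n"
  shows "v \<bullet> ((k *\<^sub>R A) *v v) = k * (v \<bullet> (A *v v))"
  by (simp add: scaleR_matrix_vector_assoc[symmetric])

text \<open>Integrability belongs to the conclusion because the Bochner integral of a non-integrable
  function is 0 by convention, which would make a bare bound on the expectation say little.\<close>

theorem theorem1:
  fixes f :: "real ^ 'n \<Rightarrow> real"
    and xt xstar :: "real ^ 'n"
    and H :: "real ^ 'n ^ 'n"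
    and \<tau> L \<gamma> \<rho> \<zeta> \<mu> \<eta> :: real
    and b d :: nat
    and M :: "'w measure"
    and u :: "nat \<Rightarrow> 'w \<Rightarrow> real ^ 'n"
  assumes d: "d = CARD('n)"
    and \<tau>: "0 < \<tau>" and convex: "strongly_convex \<tau> f"
    and smooth: "L_smooth L f"
    and \<gamma>: "0 < \<gamma>" and hess: "lipschitz_hessian \<gamma> f"
    and minimizer: "\<forall>y. f xstar \<le> f y"
    and \<mu>: "0 < \<mu>"
    and b: "1 \<le> b" "b \<le> d + 2"
    and \<rho>: "0 < \<rho>" "\<rho> \<le> 1"
    and \<zeta>: "0 < \<zeta>"
    and H: "pos_def H"
    and H_lower: "\<rho> *\<^sub>R H \<preceq>\<^sub>L hessian f xt"
    and H_upper: "hessian f xt \<preceq>\<^sub>L (2 - \<rho>) *\<^sub>R H"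
    and H_\<zeta>: "\<zeta> *\<^sub>R mat 1 \<preceq>\<^sub>L H"
    and \<eta>: "\<eta> = real b / (16 * (real d + 2))"
    and close: "norm (xt - xstar) \<le> \<rho> / \<gamma> *
          min (3 * \<tau> * \<zeta> powr (1/2) / (64 * L powr (1/2)))
              (real d powr (3/2) * \<zeta>\<^sup>2 / (33 * L * (real d + 2) * (real b)\<^sup>2))"
    and M: "prob_space M"
    and u_indep: "prob_space.indep_vars M (\<lambda>_. borel) u {1..b}"
    and u_gaussian: "\<forall>i\<in>{1..b}. distributed M lborel (u i) (\<lambda>v. ennreal (std_gaussian_density v))"
  shows "integrable M (\<lambda>\<omega>. f (zo_step f \<eta> \<mu> b H xt (\<lambda>i. u i \<omega>)) - f xstar) \<and>
         prob_space.expectation M (\<lambda>\<omega>. f (zo_step f \<eta> \<mu> b H xt (\<lambda>i. u i \<omega>)) - f xstar)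
           \<le> (1 - real b * \<rho> / (64 * (real d + 2))) * (f xt - f xstar) + zo_error d b L \<gamma> \<zeta> \<mu>"
proof -
  interpret prob_space M by (rule M)
  define h S W z where "h = gradient f xt" and "S = psd_sqrt H" and "W = inv_sqrt H" and "z = sqrt \<zeta>"
  define g where "g = W *v h"
  \<comment> \<open>The difference quotient along \<open>W *v v\<close> minus its linear part;
    \<open>W\<close> is symmetric, so that part is \<open>g \<bullet> v\<close>.\<close>
  define e where "e v = (f (xt + \<mu> *\<^sub>R (W *v v)) - f xt) / \<mu> - g \<bullet> v" for v
  define c where "c = \<mu> * L / (2 * z\<^sup>2)"
  define D B where "D = real d" and "B = real b"
  define n where "n = norm g"
  have z: "0 < z" and z2: "z\<^sup>2 = \<zeta>" using \<zeta> by (auto simp: z_def)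
  have D: "1 \<le> D" using d by (simp add: D_def Suc_le_eq)
  have B: "1 \<le> B" "B \<le> D + 2" using b by (auto simp: B_def D_def)

  have H_ge: "\<zeta> * (norm v)\<^sup>2 \<le> v \<bullet> (H *v v)" for v
    using loewner_le_imp[OF H_\<zeta>, of v] by (simp add: scaleR_matrix_form power2_norm_eq_inner)
  have Hsym: "transpose H = H" using H by (simp add: pos_def_def)
  note S_facts = psd_sqrt_works[OF Hsym \<zeta> H_ge, folded S_def]
  note W_facts = inv_sqrt_works[OF Hsym \<zeta> H_ge, folded S_def W_def]
  have W_sym: "x \<bullet> (W *v y) = (W *v x) \<bullet> y" for x y
    by (rule symmetric_inner_mult[OF W_facts(3)])
  have S_norm: "(norm (S *v v))\<^sup>2 = v \<bullet> (H *v v)" for v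
  proof -
    have "(norm (S *v v))\<^sup>2 = v \<bullet> (S *v (S *v v))"
      using symmetric_inner_mult[of S v "S *v v"] S_facts(1) by (simp add: psd_def power2_norm_eq_inner)
    then show ?thesis by (simp add: matrix_vector_mul_assoc S_facts(2))
  qed
  have W_le: "norm (W *v v) \<le> norm v / z" for v
  proof -
    have "(z * norm (W *v v))\<^sup>2 \<le> (norm (S *v (W *v v)))\<^sup>2"
      unfolding S_norm using H_ge[of "W *v v"] by (simp add: power_mult_distrib z2)
    then have "(z * norm (W *v v))\<^sup>2 \<le> (norm v)\<^sup>2" by (simp add: matrix_vector_mul_assoc W_facts(1))
    then have "z * norm (W *v v) \<le> norm v" by (rule power2_le_imp_le) simp
    then show ?thesis using z by (simp add: field_simps)
  qed
  have lower: "\<rho> * (v \<bullet> (H *v v)) \<le> v \<bullet> (hessian f xt *v v)" for v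
    using loewner_le_imp[OF H_lower, of v] by (simp add: scaleR_matrix_form)
  have upper: "v \<bullet> (hessian f xt *v v) \<le> 2 * (v \<bullet> (H *v v))" for v
  proof -
    have "v \<bullet> (hessian f xt *v v) \<le> (2 - \<rho>) * (v \<bullet> (H *v v))"
      using loewner_le_imp[OF H_upper, of v] by (simp add: scaleR_matrix_form)
    also have "\<dots> \<le> 2 * (v \<bullet> (H *v v))"
      using \<rho> by (intro mult_right_mono) (auto simp flip: S_norm)
    finally show ?thesis .
  qed

  \<comment> \<open>Any unit vector serves: evaluating the quadratic forms at it compares the
    scalars \<open>\<tau>\<close>, \<open>\<rho> * \<zeta>\<close> and \<open>L\<close>.\<close>
  define a :: "real ^ 'n" where "a = axis undefined 1"
  have a: "norm a = 1" by (simp add: a_def norm_axis_1)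
  have "\<tau> \<le> L"
    using hessian_ge_of_strongly_convex[OF hess convex, of a xt] hessian_le_of_L_smooth[OF hess smooth, of a xt]
    by (simp add: a)
  then have L: "0 < L" using \<tau> by simp
  have "\<rho> * \<zeta> \<le> \<rho> * (a \<bullet> (H *v a))"
    using H_ge[of a] \<rho> by (intro mult_left_mono) (auto simp: a)
  then have "\<rho> * \<zeta> \<le> L"
    using hessian_le_of_L_smooth[OF hess smooth, of a xt] lower[of a] by (simp add: a)
  \<comment> \<open>This is what reduces the first closeness bound to
    \<open>3 * \<tau> / 64\<close>.\<close>
  then have \<rho>z: "\<rho> * z \<le> sqrt L"
  proof -
    have "(\<rho> * z)\<^sup>2 = \<rho> * \<rho> * \<zeta>"
      by (simp add: power_mult_distrib z2) (simp add: power2_eq_square)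
    also have "\<dots> \<le> 1 * \<rho> * \<zeta>" using \<rho> \<zeta> by (intro mult_right_mono) auto
    also have "\<dots> \<le> L" using \<open>\<rho> * \<zeta> \<le> L\<close> by simp
    finally show ?thesis by (rule real_le_rsqrt)
  qed

  have close1: "norm (xt - xstar) \<le> \<rho> / \<gamma> * (3 * \<tau> * z / (64 * sqrt L))"
  proof -
    have "\<zeta> powr (1 / 2) = z" "L powr (1 / 2) = sqrt L"
      using \<zeta> L by (simp_all add: powr_half_sqrt z_def)
    with order_trans[OF close mult_left_mono[OF min.cobounded1]] show ?thesis
      using \<rho> \<gamma> by simp
  qed
  have close2: "norm (xt - xstar) \<le> \<rho> / \<gamma> * (D * sqrt D * z ^ 4 / (33 * L * (D + 2) * B\<^sup>2))"
  proof -
    have "D powr (3 / 2) = D powr (1 + 1 / 2)" by simp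
    also have "\<dots> = D * sqrt D" using D by (simp only: powr_add powr_half_sqrt) simp
    finally have "real d powr (3 / 2) * \<zeta>\<^sup>2 = D * sqrt D * z ^ 4"
      by (simp add: D_def flip: z2 power_mult)
    with order_trans[OF close mult_left_mono[OF min.cobounded2]] show ?thesis
      using \<rho> \<gamma> by (simp add: D_def B_def)
  qed

  have gap: "f xt - f xstar \<le> 32 / 63 / \<rho> * n\<^sup>2"
    unfolding n_def g_def h_def
  proof (rule suboptimality_le[OF hess convex W_facts(1) S_norm W_sym W_facts(2) lower \<rho>(1)])
    have "\<gamma> * norm (xt - xstar) \<le> \<gamma> * (\<rho> / \<gamma> * (3 * \<tau> * z / (64 * sqrt L)))"
      using \<gamma> by (intro mult_left_mono close1) auto
    also have "\<dots> = (3 * \<tau> / 64) * (\<rho> * z / sqrt L)" using \<gamma> by simp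
    also have "\<dots> \<le> (3 * \<tau> / 64) * 1"
      using \<rho>z L \<tau> by (intro mult_left_mono) auto
    finally show "\<gamma> * norm (xt - xstar) \<le> 3 * \<tau> / 64" by simp
  qed

  have n_le: "\<gamma> * n \<le> z ^ 3 * (D * sqrt D) / (33 * (D + 2) * B\<^sup>2)"
  proof -
    have "gradient f xstar = 0"
      using gradient_eq_0_at_minimum[OF smooth] minimizer by blast
    \<comment> \<open>The gradient vanishes at \<open>xstar\<close>, so smoothness turns distance
      into gradient size; \<open>L\<close> then cancels against the one in the closeness
      bound.\<close>
    then have "norm h \<le> L * norm (xt - xstar)"
      using smooth unfolding L_smooth_def h_def by (metis diff_zero)
    then have "n \<le> L * norm (xt - xstar) / z"
      unfolding n_def g_def using z by (intro order_trans[OF W_le] divide_right_mono) auto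
    also have "\<dots> \<le> L * (\<rho> / \<gamma> * (D * sqrt D * z ^ 4 / (33 * L * (D + 2) * B\<^sup>2))) / z"
      using L z by (intro divide_right_mono mult_left_mono close2) auto
    finally have "\<gamma> * n \<le> \<gamma> * (L * (\<rho> / \<gamma> * (D * sqrt D * z ^ 4 / (33 * L * (D + 2) * B\<^sup>2))) / z)"
      using \<gamma> by (intro mult_left_mono) auto
    also have "\<dots> = \<rho> * (z ^ 3 * (D * sqrt D) / (33 * (D + 2) * B\<^sup>2))"
    proof -
      have "\<gamma> * (L * (\<rho> / \<gamma> * (s * z ^ 4 / (33 * L * Q * B\<^sup>2))) / z) = \<rho> * (z ^ 3 * s / (33 * Q * B\<^sup>2))" for s Q
        using \<gamma> L z by (simp add: power4_eq_xxxx power3_eq_cube mult_ac)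
      then show ?thesis .
    qed
    also have "\<dots> \<le> 1 * (z ^ 3 * (D * sqrt D) / (33 * (D + 2) * B\<^sup>2))"
      using \<rho> z D by (intro mult_right_mono) auto
    finally show ?thesis by simp
  qed

  have f_cont: "continuous_on UNIV f"
    using smooth unfolding L_smooth_def
    by (auto intro!: continuous_at_imp_continuous_on differentiable_imp_continuous_within)
  have f_meas[measurable]: "f \<in> borel_measurable borel"
    by (rule borel_measurable_continuous_onI[OF f_cont])
  have W_meas[measurable]: "(*v) W \<in> borel_measurable borel"
    by (intro borel_measurable_continuous_onI linear_continuous_on) simp
  have e_meas: "e \<in> borel_measurable borel"
    unfolding e_def[abs_def] by measurable
  have e_le: "\<bar>e v\<bar> \<le> c * (norm v)\<^sup>2" for v
  proof -
    have "\<mu> * (g \<bullet> v) = (\<mu> *\<^sub>R (W *v v)) \<bullet> h"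
      using W_sym[of h v] by (simp add: g_def inner_commute[of h "W *v v"])
    then have "\<bar>e v\<bar> = \<bar>f (xt + \<mu> *\<^sub>R (W *v v)) - f xt - (\<mu> *\<^sub>R (W *v v)) \<bullet> h\<bar> / \<mu>"
      using \<mu> by (simp add: e_def field_simps)
    also have "\<dots> \<le> L / 2 * (norm (\<mu> *\<^sub>R (W *v v)))\<^sup>2 / \<mu>"
      unfolding h_def using \<mu> by (intro divide_right_mono L_smooth_Taylor[OF smooth]) auto
    also have "\<dots> = \<mu> * L / 2 * (norm (W *v v))\<^sup>2"
      using \<mu> by (simp add: power_mult_distrib power2_eq_square)
    also have "\<dots> \<le> \<mu> * L / 2 * (norm v / z)\<^sup>2"
      using \<mu> L by (intro mult_left_mono power_mono W_le) auto
    also have "\<dots> = c * (norm v)\<^sup>2" by (simp add: c_def power_divide)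
    finally show ?thesis .
  qed
  have c0: "0 \<le> c" using \<mu> L by (simp add: c_def)

  interpret gaussian_batch M u b e c D
    by unfold_locales (use b u_indep u_gaussian e_meas e_le in \<open>auto simp: D_def d\<close>)
  \<comment> \<open>By linearity one factor \<open>W\<close> leaves the sum, and what remains is the
    batch estimate in \<open>g\<close> and \<open>e\<close>.\<close>
  have step: "zo_step f \<eta> \<mu> b H xt (\<lambda>i. u i \<omega>) = xt - \<eta> *\<^sub>R (W *v G g \<omega>)" for \<omega>
    by (simp add: zo_step_def zo_gradient_def batch_estimate_def directional_estimate_def e_def W_def
        matrix_vector_mult_scaleR linear_sum[OF matrix_vector_mul_linear])
  have \<eta>0: "0 \<le> \<eta>" by (simp add: \<eta>)
  let ?R = "\<lambda>\<omega>. f xt - f xstar + (- \<eta> * (G g \<omega> \<bullet> g) + \<eta>\<^sup>2 * (norm (G g \<omega>))\<^sup>2 + \<gamma> / 6 * ((\<eta> / z) ^ 3 * norm (G g \<omega>) ^ 3))"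
  let ?F = "\<lambda>\<omega>. f (zo_step f \<eta> \<mu> b H xt (\<lambda>i. u i \<omega>)) - f xstar"
  have F_le: "?F \<omega> \<le> ?R \<omega>" for \<omega>
    using preconditioned_step_le[OF hess _ \<eta>0 z upper S_norm W_facts(1) W_sym W_le, of "G g \<omega>"] \<gamma>
    by (simp add: step g_def h_def)
  note int = expectation_G_inner(1)[of g g] expectation_G_norm_sq(1)[of g] expectation_G_norm_cube(1)[OF c0, of g]
  have R_int: "integrable M ?R" using int by auto
  have F_int: "integrable M ?F"
  proof (rule Bochner_Integration.integrable_bound[OF R_int])
    show "?F \<in> borel_measurable M" unfolding step by measurable
    \<comment> \<open>The minimizer makes \<open>?F\<close> nonnegative, so the one-sided descent
      bound also dominates its absolute value.\<close>
    show "AE \<omega> in M. norm (?F \<omega>) \<le> norm (?R \<omega>)"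
      using F_le minimizer by (intro AE_I2) (simp, smt (verit))
  qed
  have "expectation ?F \<le> expectation ?R"
    by (intro integral_mono F_int R_int F_le)
  also have "\<dots> = f xt - f xstar + (- \<eta> * expectation (\<lambda>\<omega>. G g \<omega> \<bullet> g) + \<eta>\<^sup>2 * expectation (\<lambda>\<omega>. (norm (G g \<omega>))\<^sup>2)
      + \<gamma> / 6 * ((\<eta> / z) ^ 3 * expectation (\<lambda>\<omega>. norm (G g \<omega>) ^ 3)))"
    using int by (simp add: prob_space)
  also have "\<dots> \<le> f xt - f xstar + (- (8 / 63 * \<eta> * n\<^sup>2) + zo_error d b L \<gamma> \<zeta> \<mu>)"
  proof -
    \<comment> \<open>Weight 1/8 in the bias bound at \<open>z = g\<close> keeps 7/8 of the squared
      norm and doubles the remainder term.\<close>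
    have "7 / 8 * n\<^sup>2 - 2 * c\<^sup>2 * (D * (D + 2)) \<le> expectation (\<lambda>\<omega>. G g \<omega> \<bullet> g)"
      using expectation_G_inner(2)[of "1 / 8" g g] by (simp add: abs_le_iff n_def power2_norm_eq_inner)
    from descent_bound[OF D B _ _ z c_def \<gamma> L \<mu> n_le this]
    show "f xt - f xstar + (- \<eta> * expectation (\<lambda>\<omega>. G g \<omega> \<bullet> g) + \<eta>\<^sup>2 * expectation (\<lambda>\<omega>. (norm (G g \<omega>))\<^sup>2)
      + \<gamma> / 6 * ((\<eta> / z) ^ 3 * expectation (\<lambda>\<omega>. norm (G g \<omega>) ^ 3))) \<le> f xt - f xstar + (- (8 / 63 * \<eta> * n\<^sup>2) + zo_error d b L \<gamma> \<zeta> \<mu>)"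
      using expectation_G_norm_sq(2)[of g] expectation_G_norm_cube(2)[OF c0, of g]
      unfolding z2[symmetric] zo_error_eq[OF z] by (simp add: n_def \<eta> D_def B_def)
  qed
  also have "\<dots> \<le> (1 - real b * \<rho> / (64 * (real d + 2))) * (f xt - f xstar) + zo_error d b L \<gamma> \<zeta> \<mu>"
  proof -
    \<comment> \<open>By the choice of \<open>\<eta>\<close> the contraction coefficient is
      \<open>\<eta> * \<rho> / 4\<close>; the factor \<open>\<rho>\<close> cancels the one in the
      gap bound.\<close>
    have "real b * \<rho> / (64 * (real d + 2)) * (f xt - f xstar) = \<eta> * \<rho> / 4 * (f xt - f xstar)"
      by (simp add: \<eta>)
    also have "\<dots> \<le> \<eta> * \<rho> / 4 * (32 / 63 / \<rho> * n\<^sup>2)"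
      using \<eta>0 \<rho> by (intro mult_left_mono gap) auto
    also have "\<dots> = 8 / 63 * \<eta> * n\<^sup>2" using \<rho> by simp
    finally show ?thesis by (simp add: left_diff_distrib)
  qed
  finally show ?thesis using F_int by blast
qed

end
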